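(* Suppose that $\tilde X$ is $\alpha$-recurrent, and that both $N_0=\{i: q_{i,0}>0\}$ and $N_0^*=\{i: q_{0,i}>0\}$ are finite. Then there exists a $\phi$ such that $I(\phi)=1$ and $I'(\phi-)<\infty$.
   Context: $X=(X_t)_{t\ge 0}$ is an irreducible, non-explosive, recurrent continuous-time Markov chain on $S=\mathbb Z^+=\{0,1,2,\dots\}$ or $S=\{0,\dots,K\}$, with distinguished state $0$; $C=S\setminus\{0\}$. Its $Q$-matrix is $(q_{i,j})$ and $q_i=-q_{i,i}$. $\tilde X$ is $X$ killed on first hitting $0$, a chain on $C$ with substochastic semigroup $(\tilde P(t))_{t\ge0}$; $\tilde X$ is assumed irreducible on $C$. $\tilde X$ is evanescent, i.e. irreducible on $C$ and dies (hits $0$) with probability one. Its decay parameter is $\alpha=\inf\{\lambda\ge0:\int_0^\infty\tilde P_{ij}(t)e^{\lambda t}dt=\infty\}$ (independent of $i,j\in C$), and $\tilde X$ is called $\alpha$-recurrent if $\int_0^\infty\tilde P_{ij}(t)e^{\alpha t}dt=\infty$ (and $\alpha$-transient otherwise). $H^1$ denotes a full holding time of $X$ in $0$ (from an entry to $0$ until the next departure), and $R^1$ the subsequent return time (from that departure until the next return to $0$); $W=H^1+R^1$. $g$ is the (defective) density of $W1_{(H^1<1)}$ on $(0,\infty)$, i.e. $\int_B g(t)\,dt=\mathbb P(W\in B,\,H^1<1)$ for Borel $B\subseteq(0,\infty)$, and $I(\lambda)=\int_0^\infty e^{\lambda t}g(t)\,dt=\mathbb E[e^{\lambda W}1_{(H^1<1)}]$.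 $I'(\phi-)$ is the left derivative of $I$ at $\phi$. *)

theory Defs
  imports "HOL-Probability.Probability"
begin

section \<open>Path functionals\<close>

text \<open>
  Paths are functions on the reals of which only the values at times \<open>t \<ge> 0\<close> matter.
  Random times are extended reals, with value \<open>\<infinity>\<close> if the event in question never happens.
\<close>

definition first_time :: "(real \<Rightarrow> nat) \<Rightarrow> ereal \<Rightarrow> nat set \<Rightarrow> ereal" where
  "first_time x s A = Inf {ereal t | t. s \<le> ereal t \<and> x t \<in> A}"

primrec jump_time :: "(real \<Rightarrow> nat) \<Rightarrow> nat \<Rightarrow> ereal" where
  "jump_time x 0 = 0"
| "jump_time x (Suc n) =
     first_time x (jump_time x n) (- {x (real_of_ereal (jump_time x n))})"

text \<open>Only meaningful if \<open>jump_time x n < \<infinity>\<close>.\<close>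
definition jump_state :: "(real \<Rightarrow> nat) \<Rightarrow> nat \<Rightarrow> nat" where
  "jump_state x n = x (real_of_ereal (jump_time x n))"

definition entry_time :: "(real \<Rightarrow> nat) \<Rightarrow> ereal" where
  "entry_time x = first_time x 0 {0}"

definition departure_time :: "(real \<Rightarrow> nat) \<Rightarrow> ereal" where
  "departure_time x = first_time x (entry_time x) (- {0})"

definition holding_time :: "(real \<Rightarrow> nat) \<Rightarrow> ereal" where
  "holding_time x = departure_time x - entry_time x"

definition return_time :: "(real \<Rightarrow> nat) \<Rightarrow> ereal" where
  "return_time x = first_time x (departure_time x) {0} - departure_time x"

definition cycle_time :: "(real \<Rightarrow> nat) \<Rightarrow> ereal" where
  "cycle_time x = holding_time x + return_time x"


section \<open>Continuous-time Markov chains\<close>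

text \<open>Stable and conservative Q-matrices.\<close>
definition Q_matrix :: "nat set \<Rightarrow> (nat \<Rightarrow> nat \<Rightarrow> real) \<Rightarrow> bool" where
  "Q_matrix S Q \<longleftrightarrow>
     (\<forall>i\<in>S. \<forall>j\<in>S. i \<noteq> j \<longrightarrow> 0 \<le> Q i j) \<and>
     (\<forall>i\<in>S. ((\<lambda>j. Q i j) has_sum 0) S)"

definition exit_rate :: "(nat \<Rightarrow> nat \<Rightarrow> real) \<Rightarrow> nat \<Rightarrow> real" where
  "exit_rate Q i = - Q i i"

text \<open>For an absorbing state (\<open>exit_rate Q i = 0\<close>) this row is zero, since \<open>0 / 0 = 0\<close>.\<close>
definition jump_prob :: "(nat \<Rightarrow> nat \<Rightarrow> real) \<Rightarrow> nat \<Rightarrow> nat \<Rightarrow> real" where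
  "jump_prob Q i j = (if i = j then 0 else Q i j / exit_rate Q i)"

text \<open>
  \<open>P i\<close> is the law under which the chain starts in \<open>i\<close>.  The process is right-continuous for
  the discrete topology on \<open>S\<close>.  The last clause is the jump chain / holding time
  description of a chain with Q-matrix \<open>Q\<close>: the successive states form a discrete-time
  Markov chain with transition matrix \<open>jump_prob Q\<close>, and given these the holding
  times are independent, the one in state \<open>i\<close> being exponential with parameter
  \<open>exit_rate Q i\<close>.
\<close>
definition markov_chain ::
  "nat set \<Rightarrow> (nat \<Rightarrow> nat \<Rightarrow> real) \<Rightarrow> (nat \<Rightarrow> 'w measure) \<Rightarrow> (real \<Rightarrow> 'w \<Rightarrow> nat) \<Rightarrow> bool" where
  "markov_chain S Q P X \<longleftrightarrow>
     Q_matrix S Q \<and>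
     (\<forall>i\<in>S. prob_space (P i) \<and>
        (\<forall>t\<ge>0. X t \<in> measurable (P i) (count_space UNIV)) \<and>
        (\<forall>\<omega>\<in>space (P i). \<forall>t\<ge>0. X t \<omega> \<in> S \<and> (\<forall>\<^sub>F s in at_right t. X s \<omega> = X t \<omega>)) \<and>
        (\<forall>n y s. (\<forall>k\<le>n. y k \<in> S) \<longrightarrow> (\<forall>k<n. (0::real) \<le> s k) \<longrightarrow>
           measure (P i)
             {\<omega> \<in> space (P i). jump_time (\<lambda>t. X t \<omega>) n < \<infinity> \<and>
                (\<forall>k\<le>n. jump_state (\<lambda>t. X t \<omega>) k = y k) \<and>
                (\<forall>k<n. jump_time (\<lambda>t. X t \<omega>) k + ereal (s k) < jump_time (\<lambda>t. X t \<omega>) (Suc k))}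
           = (if y 0 = i
              then (\<Prod>k<n. jump_prob Q (y k) (y (Suc k)) * exp (- exit_rate Q (y k) * s k))
              else 0)))"

definition non_explosive ::
  "nat set \<Rightarrow> (nat \<Rightarrow> 'w measure) \<Rightarrow> (real \<Rightarrow> 'w \<Rightarrow> nat) \<Rightarrow> bool" where
  "non_explosive S P X \<longleftrightarrow>
     (\<forall>i\<in>S. AE \<omega> in P i. (\<lambda>n. jump_time (\<lambda>t. X t \<omega>) n) \<longlonglongrightarrow> \<infinity>)"

definition irreducible_chain ::
  "nat set \<Rightarrow> (nat \<Rightarrow> 'w measure) \<Rightarrow> (real \<Rightarrow> 'w \<Rightarrow> nat) \<Rightarrow> bool" where
  "irreducible_chain S P X \<longleftrightarrow>
     (\<forall>i\<in>S. \<forall>j\<in>S. \<exists>t\<ge>0. measure (P i) {\<omega> \<in> space (P i). X t \<omega> = j} > 0)"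

definition recurrent_chain ::
  "nat set \<Rightarrow> (nat \<Rightarrow> 'w measure) \<Rightarrow> (real \<Rightarrow> 'w \<Rightarrow> nat) \<Rightarrow> bool" where
  "recurrent_chain S P X \<longleftrightarrow> (\<forall>i\<in>S. AE \<omega> in P i. \<forall>u\<ge>0. \<exists>t\<ge>u. X t \<omega> = i)"


section \<open>The chain killed on first hitting 0\<close>

definition killed_semigroup ::
  "(nat \<Rightarrow> 'w measure) \<Rightarrow> (real \<Rightarrow> 'w \<Rightarrow> nat) \<Rightarrow> nat \<Rightarrow> nat \<Rightarrow> real \<Rightarrow> real" where
  "killed_semigroup P X i j t =
     measure (P i) {\<omega> \<in> space (P i). X t \<omega> = j \<and> (\<forall>s\<in>{0..t}. X s \<omega> \<noteq> 0)}"

definition evanescent ::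
  "nat set \<Rightarrow> (nat \<Rightarrow> 'w measure) \<Rightarrow> (real \<Rightarrow> 'w \<Rightarrow> nat) \<Rightarrow> bool" where
  "evanescent S P X \<longleftrightarrow>
     (\<forall>i\<in>S - {0}. \<forall>j\<in>S - {0}. \<exists>t\<ge>0. killed_semigroup P X i j t > 0) \<and>
     (\<forall>i\<in>S - {0}. AE \<omega> in P i. \<exists>t\<ge>0. X t \<omega> = 0)"

definition killed_integral ::
  "(nat \<Rightarrow> 'w measure) \<Rightarrow> (real \<Rightarrow> 'w \<Rightarrow> nat) \<Rightarrow> nat \<Rightarrow> nat \<Rightarrow> real \<Rightarrow> ennreal" where
  "killed_integral P X i j l =
     (\<integral>\<^sup>+t\<in>{0..}. ennreal (killed_semigroup P X i j t * exp (l * t)) \<partial>lborel)"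

text \<open>
  The set is nonempty for an irreducible killed chain: remaining in \<open>i\<close> up to time \<open>s\<close> first
  gives \<open>killed_semigroup P X i j (s + t) \<ge> exp (- exit_rate Q i * s) * killed_semigroup P X i j t\<close>,
  so it contains every \<open>l \<ge> exit_rate Q i\<close>.
\<close>
definition decay_parameter ::
  "(nat \<Rightarrow> 'w measure) \<Rightarrow> (real \<Rightarrow> 'w \<Rightarrow> nat) \<Rightarrow> nat \<Rightarrow> nat \<Rightarrow> real" where
  "decay_parameter P X i j = Inf {l. 0 \<le> l \<and> killed_integral P X i j l = \<infinity>}"

text \<open>
  For an irreducible killed chain neither the decay parameter nor the divergence of the
  integral depends on \<open>i\<close> and \<open>j\<close>, so the existential quantifiers may be read as universal ones.
\<close>
definition alpha_recurrent ::
  "nat set \<Rightarrow> (nat \<Rightarrow> 'w measure) \<Rightarrow> (real \<Rightarrow> 'w \<Rightarrow> nat) \<Rightarrow> bool" where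
  "alpha_recurrent S P X \<longleftrightarrow>
     (\<exists>i\<in>S - {0}. \<exists>j\<in>S - {0}. killed_integral P X i j (decay_parameter P X i j) = \<infinity>)"


section \<open>The defective density of the cycle time\<close>

definition cycle_density :: "'w measure \<Rightarrow> (real \<Rightarrow> 'w \<Rightarrow> nat) \<Rightarrow> (real \<Rightarrow> real) \<Rightarrow> bool" where
  "cycle_density M X g \<longleftrightarrow>
     g \<in> borel_measurable borel \<and> (\<forall>t>0. 0 \<le> g t) \<and>
     (\<forall>B\<in>sets borel. B \<subseteq> {0<..} \<longrightarrow>
        (\<integral>\<^sup>+t\<in>B. ennreal (g t) \<partial>lborel) =
        emeasure M {\<omega> \<in> space M. cycle_time (\<lambda>t. X t \<omega>) \<in> ereal ` B \<and>
                                 holding_time (\<lambda>t. X t \<omega>) < 1})"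

definition cycle_mgf :: "(real \<Rightarrow> real) \<Rightarrow> real \<Rightarrow> ennreal" where
  "cycle_mgf g l = (\<integral>\<^sup>+t\<in>{0<..}. ennreal (exp (l * t) * g t) \<partial>lborel)"

text \<open>
  A finite left derivative.  The function \<open>f\<close> is extended-valued; \<open>enn2real\<close> sends \<open>\<infinity>\<close> to
  \<open>0\<close>, so finiteness of \<open>f\<close> on the left of and at the point is required separately.
\<close>
definition finite_left_derivative :: "(real \<Rightarrow> ennreal) \<Rightarrow> real \<Rightarrow> bool" where
  "finite_left_derivative f a \<longleftrightarrow>
     f a < \<infinity> \<and> (\<forall>\<^sub>F l in at_left a. f l < \<infinity>) \<and>
     (\<exists>D. ((\<lambda>l. enn2real (f l)) has_real_derivative D) (at_left a))"

end

theory Submission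
  imports Defs
begin

text \<open>
  Expand everything over the paths of the jump chain.  Given the jump chain the holding times are
  independent and exponential, so both the Green function
  \<open>G\<^sub>l(i,j) = \<integral> P\<^sub>i\<^sub>j(t) exp(l t) dt\<close> of the killed chain and the moment generating functions of the
  hitting time of 0 become sums of products over paths.  Comparing these sums gives
  \<open>I(l) = h(l) \<Sum>\<^sub>i (q\<^sub>0\<^sub>i / q\<^sub>0) \<Sum>\<^sub>j G\<^sub>l(i,j) q\<^sub>j\<^sub>0\<close>, where \<open>h(l) = E[exp(l H); H < 1]\<close> is finite and positive
  and both sums are finite by the finiteness assumptions.  Irreducibility on \<open>C\<close> makes finiteness of
  \<open>G\<^sub>l(i,j)\<close> independent of \<open>i\<close> and \<open>j\<close>, hence \<open>I\<close> is finite on \<open>[0,\<alpha>)\<close> and infinite at \<open>\<alpha>\<close>; and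
  \<open>\<alpha> > 0\<close> because 0 is hit with probability one.  On \<open>[0,\<alpha>)\<close> the function \<open>I\<close> is a power series with
  nonnegative coefficients, so it is differentiable and unbounded there.  As \<open>I(0) \<le> P(H < 1) < 1\<close>, it
  takes the value 1 at some \<open>\<phi> < \<alpha>\<close>.
\<close>

section \<open>Right-continuous step paths\<close>

text \<open>The hypotheses describe finitely many jumps and holding times at once, and only on the
  event that these jumps occur. Neither a strong Markov property nor the almost sure occurrence of
  all jumps is given. Weights of jump paths replace both: cutting a path at 0 factors its weight,
  and a family of weights of total mass 1 shows that an event is almost sure. Sums and integrals are
  \<open>ennreal\<close>-valued, so they can be exchanged before anything is known to be finite.
  \<alpha>-recurrence yields divergence of \<open>I\<close> at \<alpha>: with a finite Green
  function the same formula would give a finite value there. At \<open>l = 0\<close> the Green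
  function, weighted with the rates into 0, sums to the probability of hitting 0; this bound is
  behind \<alpha> > 0. The cut \<open>H < 1\<close> keeps \<open>h(l)\<close> finite even for
  \<open>l\<close> beyond the exit rate of 0, and it makes \<open>I(0)\<close> strictly less than 1.
  The starting state is arbitrary: the stretch before the first entry to 0 carries no exponential
  weight and has total mass 1.\<close>

lemma first_time_ge: "s \<le> first_time x s A"
  unfolding first_time_def by (rule Inf_greatest) auto

lemma first_time_le: "s \<le> ereal t \<Longrightarrow> x t \<in> A \<Longrightarrow> first_time x s A \<le> ereal t"
  unfolding first_time_def by (rule Inf_lower) auto

lemma first_time_less_iff:
  "first_time x s A < e \<longleftrightarrow> (\<exists>t. s \<le> ereal t \<and> x t \<in> A \<and> ereal t < e)"
  unfolding first_time_def by (auto simp: Inf_less_iff)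

definition right_cont_path :: "(real \<Rightarrow> nat) \<Rightarrow> bool" where
  "right_cont_path x \<longleftrightarrow> (\<forall>t\<ge>0. \<forall>\<^sub>F s in at_right t. x s = x t)"

lemma right_cont_pathE:
  assumes "right_cont_path x" "0 \<le> t"
  obtains b where "t < b" "\<And>s. t \<le> s \<Longrightarrow> s < b \<Longrightarrow> x s = x t"
proof -
  from assms have "\<forall>\<^sub>F s in at_right t. x s = x t" by (auto simp: right_cont_path_def)
  then obtain b where "t < b" "\<And>s. t < s \<Longrightarrow> s < b \<Longrightarrow> x s = x t"
    by (auto simp: eventually_at_right_field)
  then show thesis
    by (intro that[of b]) (auto simp: le_less)
qed

text \<open>The infimum is a minimum because the path is constant on some \<open>[t,b)\<close>: a
  visit to \<open>A\<close> in that interval puts \<open>x t\<close> itself into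
  \<open>A\<close>.\<close>

lemma first_time_attained:
  assumes rc: "right_cont_path x" and s: "0 \<le> s" and ft: "first_time x s A < \<infinity>"
  obtains t where "first_time x s A = ereal t" "0 \<le> t" "s \<le> ereal t" "x t \<in> A"
proof -
  have ge: "s \<le> first_time x s A" by (rule first_time_ge)
  with s ft obtain t where t: "first_time x s A = ereal t"
    by (cases "first_time x s A") auto
  with ge have st: "s \<le> ereal t" by simp
  with s have t0: "0 \<le> t" by (metis ereal_less_eq(5) order_trans)
  obtain b where b: "t < b" "\<And>u. t \<le> u \<Longrightarrow> u < b \<Longrightarrow> x u = x t"
    using right_cont_pathE[OF rc t0] by blast
  from b(1) t have "first_time x s A < ereal b" by simp
  then obtain u where u: "s \<le> ereal u" "x u \<in> A" "u < b"
    by (auto simp: first_time_less_iff)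
  from u have "first_time x s A \<le> ereal u" by (intro first_time_le)
  with t have "t \<le> u" by simp
  with u b have "x t \<in> A" by metis
  with t t0 st show thesis by (rule that)
qed

lemma jump_time_nonneg: "0 \<le> jump_time x n"
proof (induction n)
  case (Suc n)
  then show ?case using first_time_ge order_trans by fastforce
qed simp

lemma jump_time_mono: "m \<le> n \<Longrightarrow> jump_time x m \<le> jump_time x n"
  by (rule lift_Suc_mono_le) (auto intro: first_time_ge)

lemma jump_time_real:
  "jump_time x n < \<infinity> \<Longrightarrow> ereal (real_of_ereal (jump_time x n)) = jump_time x n"
  using jump_time_nonneg[of x n] by (cases "jump_time x n") auto

lemma jump_time_less_Suc:
  assumes rc: "right_cont_path x" and fin: "jump_time x n < \<infinity>"
  shows "jump_time x n < jump_time x (Suc n)"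
proof -
  define t where "t = real_of_ereal (jump_time x n)"
  have t: "jump_time x n = ereal t" using jump_time_real[OF fin] by (simp add: t_def)
  with jump_time_nonneg[of x n] have t0: "0 \<le> t" by simp
  obtain b where b: "t < b" "\<And>u. t \<le> u \<Longrightarrow> u < b \<Longrightarrow> x u = x t"
    using right_cont_pathE[OF rc t0] by blast
  have "\<not> jump_time x (Suc n) < ereal b"
    using b(2) by (auto simp: first_time_less_iff t)
  with b(1) t show ?thesis by (metis ereal_less(2) less_ereal.simps(1) not_less order_less_le_trans)
qed

lemma jump_state_Suc_neq:
  assumes rc: "right_cont_path x" and fin: "jump_time x (Suc n) < \<infinity>"
  shows "jump_state x (Suc n) \<noteq> jump_state x n"
proof -
  from fin obtain t where "jump_time x (Suc n) = ereal t" "x t \<in> - {x (real_of_ereal (jump_time x n))}"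
    using first_time_attained[OF rc jump_time_nonneg, of x n] by (metis jump_time.simps(2))
  then show ?thesis by (simp add: jump_state_def)
qed

lemma path_between_jumps:
  assumes "jump_time x n \<le> ereal t" "ereal t < jump_time x (Suc n)"
  shows "x t = jump_state x n"
  using assms first_time_le[of "jump_time x n" t x] unfolding jump_state_def
  by (metis ComplI jump_time.simps(2) linorder_not_le singletonD)

lemma jump_index_exists:
  assumes t: "0 \<le> t" and n: "ereal t < jump_time x n"
  obtains k where "k < n" "jump_time x k \<le> ereal t" "ereal t < jump_time x (Suc k)"
proof -
  define l where "l = (LEAST l. ereal t < jump_time x l)"
  have l: "ereal t < jump_time x l" unfolding l_def using n by (rule LeastI)
  have ln: "l \<le> n" unfolding l_def using n by (rule Least_le)
  from l t have "l \<noteq> 0" by (cases l) auto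
  then obtain k where k: "l = Suc k" by (cases l) auto
  then have "\<not> ereal t < jump_time x k" using not_less_Least[of k "\<lambda>l. ereal t < jump_time x l"] by (simp add: l_def)
  with l k ln show thesis by (intro that[of k]) auto
qed

text \<open>The path is constant between jumps, so hitting times reduce to indices of the jump
  chain.\<close>

lemma first_time_eq_jump_time:
  assumes mn: "m \<le> n" and fin: "jump_time x n < \<infinity>"
    and A: "jump_state x n \<in> A" and notA: "\<And>k. m \<le> k \<Longrightarrow> k < n \<Longrightarrow> jump_state x k \<notin> A"
  shows "first_time x (jump_time x m) A = jump_time x n"
proof (rule antisym)
  have n: "ereal (real_of_ereal (jump_time x n)) = jump_time x n" by (rule jump_time_real[OF fin])
  then show "first_time x (jump_time x m) A \<le> jump_time x n"
    using first_time_le[of "jump_time x m" "real_of_ereal (jump_time x n)" x A] A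
      jump_time_mono[OF mn, of x] by (simp add: jump_state_def)
  show "jump_time x n \<le> first_time x (jump_time x m) A"
  proof (rule ccontr)
    assume "\<not> ?thesis"
    then obtain t where t: "jump_time x m \<le> ereal t" "x t \<in> A" "ereal t < jump_time x n"
      by (auto simp: first_time_less_iff not_le)
    have "0 \<le> t" using order_trans[OF jump_time_nonneg t(1)] by simp
    then obtain k where k: "k < n" "jump_time x k \<le> ereal t" "ereal t < jump_time x (Suc k)"
      using jump_index_exists t(3) by blast
    have "m \<le> k"
    proof (rule ccontr)
      assume "\<not> m \<le> k"
      then have "jump_time x (Suc k) \<le> jump_time x m" by (intro jump_time_mono) auto
      with k t show False by auto
    qed
    with notA[of k] k path_between_jumps[of x k t] t show False by auto
  qed
qed

section \<open>Regular paths and the indices of the first cycle\<close>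

definition regular_path :: "(real \<Rightarrow> nat) \<Rightarrow> bool" where
  "regular_path x \<longleftrightarrow> right_cont_path x \<and> (\<forall>n. jump_time x n < \<infinity>) \<and>
     (\<lambda>n. jump_time x n) \<longlonglongrightarrow> \<infinity>"

text \<open>The holding time as a real number; since \<open>real_of_ereal\<close> sends \<infinity>
  to 0, it has this meaning only for finite jump times.\<close>

definition sojourn :: "(real \<Rightarrow> nat) \<Rightarrow> nat \<Rightarrow> real" where
  "sojourn x n = real_of_ereal (jump_time x (Suc n)) - real_of_ereal (jump_time x n)"

lemma sum_sojourn: "(\<Sum>k\<in>{m..<n}. sojourn x k) =
    real_of_ereal (jump_time x n) - real_of_ereal (jump_time x m)" if "m \<le> n"
  using that unfolding sojourn_def by (rule sum_Suc_diff')

text \<open>Non-explosion makes the intervals between jumps cover all of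
  \<open>[0,\<infinity>)\<close>.\<close>

lemma jump_index_regular:
  assumes "regular_path x" "0 \<le> t"
  obtains n where "jump_time x n \<le> ereal t" "ereal t < jump_time x (Suc n)"
proof -
  have "(\<lambda>n. jump_time x n) \<longlonglongrightarrow> \<infinity>" using assms by (simp add: regular_path_def)
  then have "\<forall>\<^sub>F n in sequentially. ereal t < jump_time x n"
    using order_tendstoD(1)[of _ "\<infinity>::ereal"] by fastforce
  then obtain n where "ereal t < jump_time x n" by (auto simp: eventually_sequentially)
  then show thesis using jump_index_exists[OF assms(2)] that by blast
qed

lemma jump_index_unique:
  assumes "jump_time x n \<le> ereal t" "ereal t < jump_time x (Suc n)"
    "jump_time x m \<le> ereal t" "ereal t < jump_time x (Suc m)"
  shows "m = n"
proof (rule ccontr)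
  assume "m \<noteq> n"
  then have "Suc m \<le> n \<or> Suc n \<le> m" by auto
  with assms jump_time_mono[of "Suc m" n x] jump_time_mono[of "Suc n" m x] show False by (metis leD order_trans)
qed

lemma regular_path_jump_state:
  assumes "regular_path x" "0 \<le> t"
  shows "\<exists>n. jump_state x n = x t"
  using jump_index_regular[OF assms] path_between_jumps by metis

lemma sojourn_pos:
  assumes rc: "right_cont_path x" and fin: "jump_time x (Suc n) < \<infinity>"
  shows "0 < sojourn x n"
proof -
  have n: "jump_time x n < \<infinity>" using order_le_less_trans[OF jump_time_mono fin, of n] by simp
  from jump_time_less_Suc[OF rc n] jump_time_real[OF n] jump_time_real[OF fin]
  show ?thesis unfolding sojourn_def by (metis diff_gt_0_iff_gt less_ereal.simps(1))
qed

text \<open>The excursion away from 0 consists of the \<open>m\<close> states between the indices \<open>N\<close> and \<open>N + m + 1\<close>.\<close>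
definition first_cycle_at :: "(nat \<Rightarrow> nat) \<Rightarrow> nat \<Rightarrow> nat \<Rightarrow> bool" where
  "first_cycle_at y N m \<longleftrightarrow> (\<forall>k<N. y k \<noteq> 0) \<and> y N = 0 \<and>
     (\<forall>k. N < k \<longrightarrow> k \<le> N + m \<longrightarrow> y k \<noteq> 0) \<and> y (N + m + 1) = 0"

text \<open>Ensures that in double sums over \<open>N\<close> and \<open>m\<close> at most one term
  is nonzero on each path.\<close>

lemma first_cycle_at_unique:
  assumes "first_cycle_at y N m" "first_cycle_at y N' m'"
  shows "N' = N \<and> m' = m"
proof
  show N: "N' = N"
    using assms unfolding first_cycle_at_def by (metis nat_neq_iff)
  show "m' = m"
  proof (rule ccontr)
    assume "m' \<noteq> m"
    then consider "m' < m" | "m < m'" by linarith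
    then show False
    proof cases
      case 1
      then have "N < N + m' + 1" "N + m' + 1 \<le> N + m" by auto
      with assms N show False unfolding first_cycle_at_def by blast
    next
      case 2
      then have "N < N + m + 1" "N + m + 1 \<le> N + m'" by auto
      with assms N show False unfolding first_cycle_at_def by blast
    qed
  qed
qed

text \<open>Entry, departure and return are the jump times with indices \<open>N\<close>,
  \<open>Suc N\<close> and \<open>N + m + 1\<close>, so the cycle consists of the sojourns
  \<open>N\<close> to \<open>N + m\<close>.\<close>

lemma first_cycle_at_times:
  assumes reg: "regular_path x" and cyc: "first_cycle_at (jump_state x) N m"
  shows "holding_time x = ereal (sojourn x N)"
    and "cycle_time x = ereal (\<Sum>k\<in>{N..N+m}. sojourn x k)"
    and "0 < (\<Sum>k\<in>{N..N+m}. sojourn x k)"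
proof -
  have rc: "right_cont_path x" and fin: "\<And>n. jump_time x n < \<infinity>" using reg by (auto simp: regular_path_def)
  have N0: "jump_state x N = 0" and Nl: "\<And>k. k < N \<Longrightarrow> jump_state x k \<noteq> 0"
    and m0: "jump_state x (N + m + 1) = 0"
    and ml: "\<And>k. N < k \<Longrightarrow> k \<le> N + m \<Longrightarrow> jump_state x k \<noteq> 0"
    using cyc by (auto simp: first_cycle_at_def)
  define t where "t n = real_of_ereal (jump_time x n)" for n
  have t: "jump_time x n = ereal (t n)" for n
    unfolding t_def using fin by (rule jump_time_real[symmetric])
  have soj: "sojourn x n = t (Suc n) - t n" for n
    by (simp add: sojourn_def t_def del: jump_time.simps)
  have e: "entry_time x = jump_time x N"
    unfolding entry_time_def using first_time_eq_jump_time[of 0 N x "{0}"] fin N0 Nl by simp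
  \<comment> \<open>Successive jump states differ; this also disposes of \<open>m = 0\<close>, which
    \<open>first_cycle_at\<close> alone does not exclude.\<close>
  have "jump_state x (Suc N) \<noteq> 0" using jump_state_Suc_neq[OF rc fin, of N] N0 by simp
  then have d: "departure_time x = jump_time x (Suc N)"
    unfolding departure_time_def e
    using first_time_eq_jump_time[of N "Suc N" x "- {0}"] fin N0 by (simp add: le_less_Suc_eq del: jump_time.simps)
  have r: "first_time x (departure_time x) {0} = jump_time x (N + m + 1)"
    unfolding d using first_time_eq_jump_time[of "Suc N" "N + m + 1" x "{0}"] fin m0 ml
    by (simp add: less_Suc_eq_le Suc_le_eq del: jump_time.simps)
  have h: "holding_time x = ereal (sojourn x N)"
    by (simp add: holding_time_def d e soj t del: jump_time.simps)
  have "cycle_time x = ereal (sojourn x N) + (jump_time x (N + m + 1) - departure_time x)"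
    by (simp only: cycle_time_def return_time_def r h)
  also have "\<dots> = ereal (t (N + m + 1) - t N)"
    by (simp add: d soj t del: jump_time.simps)
  also have "t (N + m + 1) - t N = (\<Sum>k\<in>{N..N+m}. sojourn x k)"
    using sum_sojourn[of N "N + m + 1" x]
    by (simp add: atLeastLessThanSuc_atLeastAtMost t_def del: jump_time.simps)
  finally have c: "cycle_time x = ereal (\<Sum>k\<in>{N..N+m}. sojourn x k)" .
  show "0 < (\<Sum>k\<in>{N..N+m}. sojourn x k)" by (intro sum_pos) (auto intro: sojourn_pos[OF rc fin])
  show "holding_time x = ereal (sojourn x N)" "cycle_time x = ereal (\<Sum>k\<in>{N..N+m}. sojourn x k)"
    by fact+
qed

section \<open>Measurability of jump times and states\<close>

text \<open>By right-continuity a visit to \<open>A\<close> before \<open>a\<close> persists on an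
  interval and so happens at a rational time; the event becomes a countable union. The set depends
  on \<open>\<omega>\<close> because a jump leaves the current, random state.\<close>

lemma measurable_first_time:
  fixes X :: "real \<Rightarrow> 'w \<Rightarrow> nat" and \<sigma> :: "'w \<Rightarrow> ereal"
  assumes rc: "\<And>\<omega>. \<omega> \<in> space M \<Longrightarrow> right_cont_path (\<lambda>t. X t \<omega>)"
    and \<sigma> [measurable]: "\<sigma> \<in> borel_measurable M" and \<sigma>0: "\<And>\<omega>. \<omega> \<in> space M \<Longrightarrow> 0 \<le> \<sigma> \<omega>"
    and A: "\<And>r. 0 \<le> r \<Longrightarrow> Measurable.pred M (\<lambda>\<omega>. X r \<omega> \<in> A \<omega>)"
  shows "(\<lambda>\<omega>. first_time (\<lambda>t. X t \<omega>) (\<sigma> \<omega>) (A \<omega>)) \<in> borel_measurable M"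
proof (rule borel_measurableI_less)
  fix a :: ereal
  have eq: "first_time (\<lambda>t. X t \<omega>) (\<sigma> \<omega>) (A \<omega>) < a \<longleftrightarrow>
      (\<exists>r::rat. 0 \<le> r \<and> \<sigma> \<omega> \<le> ereal (of_rat r) \<and> ereal (of_rat r) < a \<and> X (of_rat r) \<omega> \<in> A \<omega>)"
    (is "?L \<longleftrightarrow> ?R") if \<omega>: "\<omega> \<in> space M" for \<omega>
  proof
    assume ?L
    then obtain t where t: "\<sigma> \<omega> \<le> ereal t" "X t \<omega> \<in> A \<omega>" "ereal t < a"
      by (auto simp: first_time_less_iff)
    have t0: "0 \<le> t" using order_trans[OF \<sigma>0[OF \<omega>] t(1)] by simp
    obtain b where b: "t < b" "\<And>s. t \<le> s \<Longrightarrow> s < b \<Longrightarrow> X s \<omega> = X t \<omega>"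
      using right_cont_pathE[OF rc[OF \<omega>] t0] by blast
    obtain c where c: "t < c" "c \<le> b" "ereal c \<le> a"
    proof (cases "a = \<infinity>")
      case True
      show thesis by (rule that[of b]) (use b(1) True in auto)
    next
      case False
      with t(3) obtain a' where a': "a = ereal a'" by (cases a) auto
      show thesis by (rule that[of "min a' b"]) (use b(1) t(3) a' in auto)
    qed
    obtain r :: rat where r: "t < of_rat r" "of_rat r < c" using of_rat_dense[OF c(1)] by blast
    have "0 < (of_rat r :: real)" using r t0 by linarith
    then have "0 \<le> r" by simp
    moreover have "\<sigma> \<omega> \<le> ereal (of_rat r)" using order_trans[OF t(1)] r(1) by simp
    moreover have "ereal (of_rat r) < a" using r(2) by (intro order_less_le_trans[OF _ c(3)]) simp
    moreover have "X (of_rat r) \<omega> \<in> A \<omega>" using b(2)[of "of_rat r"] r c t by simp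
    ultimately show ?R by blast
  next
    assume ?R
    then show ?L unfolding first_time_less_iff by blast
  qed
  have *: "Measurable.pred M (\<lambda>\<omega>. 0 \<le> r \<and> \<sigma> \<omega> \<le> ereal (of_rat r) \<and> ereal (of_rat r) < a \<and> X (of_rat r) \<omega> \<in> A \<omega>)"
    for r :: rat
  proof (cases "0 \<le> r")
    case True
    then have [measurable]: "Measurable.pred M (\<lambda>\<omega>. X (of_rat r) \<omega> \<in> A \<omega>)" by (intro A) simp
    show ?thesis by measurable
  qed simp
  have "Measurable.pred M (\<lambda>\<omega>. \<exists>r::rat. 0 \<le> r \<and> \<sigma> \<omega> \<le> ereal (of_rat r) \<and> ereal (of_rat r) < a \<and> X (of_rat r) \<omega> \<in> A \<omega>)"
    by (intro pred_intros_countable *)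
  from predE[OF this] show "{\<omega> \<in> space M. first_time (\<lambda>t. X t \<omega>) (\<sigma> \<omega>) (A \<omega>) < a} \<in> sets M"
    by (rule back_subst[where P="\<lambda>E. E \<in> sets M"]) (intro Collect_cong conj_cong refl eq[symmetric])
qed

text \<open>The value at time \<tau> is \<open>j\<close> iff it is \<open>j\<close> at all rational
  times shortly after \<tau>, by right-continuity. Only rationals \<open>r \<ge> 0\<close> occur,
  where \<open>X\<close> is known to be measurable.\<close>

lemma measurable_at_random_time:
  fixes X :: "real \<Rightarrow> 'w \<Rightarrow> nat" and \<tau> :: "'w \<Rightarrow> real"
  assumes rc: "\<And>\<omega>. \<omega> \<in> space M \<Longrightarrow> right_cont_path (\<lambda>t. X t \<omega>)"
    and X: "\<And>t. 0 \<le> t \<Longrightarrow> X t \<in> measurable M (count_space UNIV)"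
    and \<tau> [measurable]: "\<tau> \<in> borel_measurable M" and \<tau>0: "\<And>\<omega>. \<omega> \<in> space M \<Longrightarrow> 0 \<le> \<tau> \<omega>"
  shows "(\<lambda>\<omega>. X (\<tau> \<omega>) \<omega>) \<in> measurable M (count_space UNIV)"
proof -
  have eq: "X (\<tau> \<omega>) \<omega> = j \<longleftrightarrow> (\<exists>q::rat. \<tau> \<omega> < of_rat q \<and>
      (\<forall>r::rat. 0 \<le> r \<longrightarrow> \<tau> \<omega> < of_rat r \<longrightarrow> r < q \<longrightarrow> X (of_rat r) \<omega> = j))" (is "?L \<longleftrightarrow> ?R")
    if \<omega>: "\<omega> \<in> space M" for \<omega> j
  proof -
    obtain b where b: "\<tau> \<omega> < b" "\<And>s. \<tau> \<omega> \<le> s \<Longrightarrow> s < b \<Longrightarrow> X s \<omega> = X (\<tau> \<omega>) \<omega>"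
      using right_cont_pathE[OF rc[OF \<omega>] \<tau>0[OF \<omega>]] by blast
    show ?thesis
    proof
      assume ?L
      obtain q :: rat where q: "\<tau> \<omega> < of_rat q" "of_rat q < b" using of_rat_dense[OF b(1)] by blast
      have "X (of_rat r) \<omega> = j" if "\<tau> \<omega> < of_rat r" "r < q" for r
      proof -
        have "(of_rat r :: real) < of_rat q" using that by (simp add: of_rat_less)
        with that q b(2)[of "of_rat r"] \<open>?L\<close> show ?thesis by simp
      qed
      with q show ?R by blast
    next
      assume ?R
      then obtain q :: rat where q: "\<tau> \<omega> < of_rat q"
        "\<And>r::rat. 0 \<le> r \<Longrightarrow> \<tau> \<omega> < of_rat r \<Longrightarrow> r < q \<Longrightarrow> X (of_rat r) \<omega> = j" by blast
      from q(1) b(1) have "\<tau> \<omega> < min (of_rat q) b" by simp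
      then obtain r :: rat where r: "\<tau> \<omega> < of_rat r" "of_rat r < min (of_rat q) b"
        using of_rat_dense by blast
      have "0 < (of_rat r :: real)" using r \<tau>0[OF \<omega>] by linarith
      then have "0 \<le> r" by simp
      with r q(2)[of r] b(2)[of "of_rat r"] show ?L by (simp add: of_rat_less)
    qed
  qed
  have below: "Measurable.pred M (\<lambda>\<omega>. 0 \<le> r \<longrightarrow> \<tau> \<omega> < of_rat r \<longrightarrow> r < q \<longrightarrow> X (of_rat r) \<omega> = j)"
    for r q :: rat and j
  proof (cases "0 \<le> r")
    case True
    then have [measurable]: "X (of_rat r) \<in> measurable M (count_space UNIV)" using X by simp
    show ?thesis by measurable
  qed simp
  have \<tau>_less: "Measurable.pred M (\<lambda>\<omega>. \<tau> \<omega> < of_rat q)" for q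
    by measurable
  have "{\<omega> \<in> space M. X (\<tau> \<omega>) \<omega> = j} \<in> sets M" for j
  proof -
    have "Measurable.pred M (\<lambda>\<omega>. \<exists>q::rat. \<tau> \<omega> < of_rat q \<and>
        (\<forall>r::rat. 0 \<le> r \<longrightarrow> \<tau> \<omega> < of_rat r \<longrightarrow> r < q \<longrightarrow> X (of_rat r) \<omega> = j))"
      by (intro pred_intros_countable pred_intros_logic(3) \<tau>_less below)
    from predE[OF this] show ?thesis
      by (rule back_subst[where P="\<lambda>E. E \<in> sets M"]) (intro Collect_cong conj_cong refl eq[symmetric])
  qed
  moreover have "(\<lambda>\<omega>. X (\<tau> \<omega>) \<omega>) -` {j} \<inter> space M = {\<omega> \<in> space M. X (\<tau> \<omega>) \<omega> = j}" for j
    by auto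
  ultimately show ?thesis
    by (subst measurable_count_space_eq2_countable) auto
qed

text \<open>The two claims are intertwined: the state with index \<open>n\<close> needs the jump
  time with that index, and the next jump time needs that state.\<close>

lemma measurable_jump_time_state:
  fixes X :: "real \<Rightarrow> 'w \<Rightarrow> nat"
  assumes rc: "\<And>\<omega>. \<omega> \<in> space M \<Longrightarrow> right_cont_path (\<lambda>t. X t \<omega>)"
    and X: "\<And>t. 0 \<le> t \<Longrightarrow> X t \<in> measurable M (count_space UNIV)"
  shows measurable_jump_time: "(\<lambda>\<omega>. jump_time (\<lambda>t. X t \<omega>) n) \<in> borel_measurable M"
    and measurable_jump_state: "(\<lambda>\<omega>. jump_state (\<lambda>t. X t \<omega>) n) \<in> measurable M (count_space UNIV)"
proof -
  have state: "(\<lambda>\<omega>. jump_state (\<lambda>t. X t \<omega>) n) \<in> measurable M (count_space UNIV)"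
    if [measurable]: "(\<lambda>\<omega>. jump_time (\<lambda>t. X t \<omega>) n) \<in> borel_measurable M" for n
    unfolding jump_state_def
    by (rule measurable_at_random_time[OF rc X])
      (auto intro: real_of_ereal_pos jump_time_nonneg)
  show time: "(\<lambda>\<omega>. jump_time (\<lambda>t. X t \<omega>) n) \<in> borel_measurable M"
  proof (induction n)
    case (Suc n)
    show ?case unfolding jump_time.simps
    proof (rule measurable_first_time[OF rc])
      fix r :: real assume "0 \<le> r"
      then have [measurable]: "X r \<in> measurable M (count_space UNIV)" by (rule X)
      show "Measurable.pred M (\<lambda>\<omega>. X r \<omega> \<in> - {X (real_of_ereal (jump_time (\<lambda>t. X t \<omega>) n)) \<omega>})"
      proof -
        note [measurable] = state[OF Suc, unfolded jump_state_def]
        have "Measurable.pred M (\<lambda>\<omega>. \<exists>j. X r \<omega> \<noteq> j \<and> X (real_of_ereal (jump_time (\<lambda>t. X t \<omega>) n)) \<omega> = j)"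
          by measurable
        then show ?thesis by simp
      qed
    qed (use Suc jump_time_nonneg in auto)
  qed simp
  show "(\<lambda>\<omega>. jump_state (\<lambda>t. X t \<omega>) n) \<in> measurable M (count_space UNIV)" by (rule state[OF time])
qed

section \<open>The joint law of the jump chain and the holding times\<close>

text \<open>The tails over all boxes determine the joint law of the \<open>Z k\<close> under
  \<open>M\<close>: it is \<open>c\<close> times a product measure. The induction peels off the last
  coordinate and moves it into the measure, hence the arbitrary \<open>M\<close> and
  \<open>c\<close>. The constant need not be 1, since the application is to the event of one jump
  path.\<close>

lemma nn_integral_prod_of_tails:
  fixes \<nu> :: "nat \<Rightarrow> real measure" and Z :: "nat \<Rightarrow> 'w \<Rightarrow> real" and f :: "nat \<Rightarrow> real \<Rightarrow> ennreal"
  assumes Z: "\<And>k. k < n \<Longrightarrow> Z k \<in> borel_measurable M"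
    and f: "\<And>k. k < n \<Longrightarrow> f k \<in> borel_measurable borel"
    and \<nu>: "\<And>k. k < n \<Longrightarrow> prob_space (\<nu> k)" "\<And>k. k < n \<Longrightarrow> sets (\<nu> k) = sets borel"
    and c: "c < \<infinity>"
    and tails: "\<And>s. emeasure M {\<omega> \<in> space M. \<forall>k<n. s k < Z k \<omega>} = c * (\<Prod>k<n. emeasure (\<nu> k) {s k<..})"
  shows "(\<integral>\<^sup>+\<omega>. (\<Prod>k<n. f k (Z k \<omega>)) \<partial>M) = c * (\<Prod>k<n. \<integral>\<^sup>+s. f k s \<partial>\<nu> k)"
  using Z f \<nu> c tails
proof (induction n arbitrary: M c)
  case 0
  then show ?case by simp
next
  case (Suc n)
  have [measurable]: "\<And>k. k < n \<Longrightarrow> Z k \<in> borel_measurable M" "Z n \<in> borel_measurable M"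
    "\<And>k. k < n \<Longrightarrow> f k \<in> borel_measurable borel" "f n \<in> borel_measurable borel"
    using Suc.prems by auto
  interpret \<nu>n: prob_space "\<nu> n" using Suc.prems by simp
  have sets_\<nu>n [measurable_cong]: "sets (\<nu> n) = sets borel" using Suc.prems by simp
  have le1: "emeasure (\<nu> k) A \<le> 1" if "k < Suc n" for k A
    using Suc.prems(3)[OF that] by (rule prob_space.emeasure_le_1)
  \<comment> \<open>The condition on the last coordinate extends from half-lines to Borel sets by
    uniqueness of measures; finiteness of \<open>c\<close> enters there.\<close>
  have box: "emeasure M {\<omega> \<in> space M. (\<forall>k<n. s k < Z k \<omega>) \<and> Z n \<omega> \<in> B}
      = c * emeasure (\<nu> n) B * (\<Prod>k<n. emeasure (\<nu> k) {s k<..})"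
    if B: "B \<in> sets borel" for s B
  proof -
    define E where "E = {\<omega> \<in> space M. \<forall>k<n. s k < Z k \<omega>}"
    have E [measurable]: "E \<in> sets M" unfolding E_def by measurable
    define c' where "c' = c * (\<Prod>k<n. emeasure (\<nu> k) {s k<..})"
    have "distr (restrict_space M E) borel (Z n) = scale_measure c' (\<nu> n)"
    proof (rule measure_eqI_lessThan)
      fix a
      have "emeasure (distr (restrict_space M E) borel (Z n)) {a<..}
          = emeasure (restrict_space M E) (Z n -` {a<..} \<inter> space (restrict_space M E))"
        by (subst emeasure_distr) (auto intro: measurable_restrict_space1)
      also have "\<dots> = emeasure M (Z n -` {a<..} \<inter> space (restrict_space M E))"
        by (subst emeasure_restrict_space) (auto simp: space_restrict_space)
      also have "Z n -` {a<..} \<inter> space (restrict_space M E) =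
          {\<omega> \<in> space M. \<forall>k<Suc n. (s(n := a)) k < Z k \<omega>}"
        using sets.sets_into_space[OF E] by (auto simp: space_restrict_space E_def less_Suc_eq)
      also have "emeasure M \<dots> = c' * emeasure (\<nu> n) {a<..}"
        by (subst Suc.prems(6)) (simp add: c'_def mult.assoc)
      finally have eq: "emeasure (distr (restrict_space M E) borel (Z n)) {a<..} = c' * emeasure (\<nu> n) {a<..}" .
      then show "emeasure (distr (restrict_space M E) borel (Z n)) {a<..} =
          emeasure (scale_measure c' (\<nu> n)) {a<..}" by simp
      have "(\<Prod>k<n. emeasure (\<nu> k) {s k<..}) < \<infinity>"
        using le1 by (auto simp: ennreal_prod_eq_top less_top[symmetric]) (metis ennreal_one_neq_top less_Suc_eq top.extremum_unique)
      then show "emeasure (distr (restrict_space M E) borel (Z n)) {a<..} < \<infinity>"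
        unfolding eq c'_def using Suc.prems(5)
        by (auto simp: ennreal_mult_eq_top_iff less_top[symmetric])
    qed (auto simp: sets_\<nu>n)
    then have "emeasure (distr (restrict_space M E) borel (Z n)) B = c' * emeasure (\<nu> n) B" by simp
    moreover have "emeasure (distr (restrict_space M E) borel (Z n)) B
        = emeasure M (Z n -` B \<inter> space (restrict_space M E))"
      using B by (subst emeasure_distr, auto intro: measurable_restrict_space1)
         (subst emeasure_restrict_space, auto simp: space_restrict_space)
    moreover have "Z n -` B \<inter> space (restrict_space M E) = {\<omega> \<in> space M. (\<forall>k<n. s k < Z k \<omega>) \<and> Z n \<omega> \<in> B}"
      using sets.sets_into_space[OF E] by (auto simp: space_restrict_space E_def)
    ultimately show ?thesis by (simp add: c'_def mult_ac)
  qed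
  define F where "F \<omega> = (\<Prod>k<n. f k (Z k \<omega>))" for \<omega>
  have [measurable]: "F \<in> borel_measurable M" unfolding F_def by measurable
  define d where "d = c * (\<Prod>k<n. \<integral>\<^sup>+s. f k s \<partial>\<nu> k)"
  \<comment> \<open>The factors of the first \<open>n\<close> coordinates become a density, under
    which the law of \<open>Z n\<close> is still a multiple of \<open>\<nu> n\<close>.\<close>
  have "distr (density M F) borel (Z n) = scale_measure d (\<nu> n)"
  proof (rule measure_eqI)
    fix B :: "real set" assume "B \<in> sets (distr (density M F) borel (Z n))"
    then have [measurable]: "B \<in> sets borel" by simp
    \<comment> \<open>On the event that \<open>Z n\<close> lies in \<open>B\<close> the induction
      hypothesis covers the remaining coordinates, with constant
      \<open>c * emeasure (\<nu> n) B\<close>.\<close>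
    define M' where "M' = density M (\<lambda>\<omega>. indicator B (Z n \<omega>))"
    have "(\<integral>\<^sup>+\<omega>. F \<omega> \<partial>M') = (c * emeasure (\<nu> n) B) * (\<Prod>k<n. \<integral>\<^sup>+s. f k s \<partial>\<nu> k)"
      unfolding F_def
    proof (rule Suc.IH)
      show "c * emeasure (\<nu> n) B < \<infinity>"
        using Suc.prems(5) by (auto simp: ennreal_mult_eq_top_iff less_top[symmetric])
      fix s :: "nat \<Rightarrow> real"
      define E where "E = {\<omega> \<in> space M. \<forall>k<n. s k < Z k \<omega>}"
      have E [measurable]: "E \<in> sets M" unfolding E_def by measurable
      have "emeasure M' E = (\<integral>\<^sup>+\<omega>. indicator B (Z n \<omega>) * indicator E \<omega> \<partial>M)"
        unfolding M'_def by (rule emeasure_density) measurable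
      also have "\<dots> = (\<integral>\<^sup>+\<omega>. indicator (E \<inter> (Z n -` B \<inter> space M)) \<omega> \<partial>M)"
        by (rule nn_integral_cong) (simp split: split_indicator)
      also have "\<dots> = emeasure M (E \<inter> (Z n -` B \<inter> space M))"
        by (rule nn_integral_indicator) measurable
      also have "E \<inter> (Z n -` B \<inter> space M) = {\<omega> \<in> space M. (\<forall>k<n. s k < Z k \<omega>) \<and> Z n \<omega> \<in> B}"
        by (auto simp: E_def)
      finally show "emeasure M' {\<omega> \<in> space M'. \<forall>k<n. s k < Z k \<omega>} =
          c * emeasure (\<nu> n) B * (\<Prod>k<n. emeasure (\<nu> k) {s k<..})"
        by (simp add: box M'_def E_def)
    qed (use Suc.prems in \<open>auto simp: M'_def\<close>)
    moreover have "(\<integral>\<^sup>+\<omega>. F \<omega> \<partial>M') = emeasure (density M F) (Z n -` B \<inter> space M)"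
    proof -
      have "(\<integral>\<^sup>+\<omega>. F \<omega> \<partial>M') = (\<integral>\<^sup>+\<omega>. indicator B (Z n \<omega>) * F \<omega> \<partial>M)"
        unfolding M'_def by (rule nn_integral_density) measurable
      also have "\<dots> = (\<integral>\<^sup>+\<omega>. F \<omega> * indicator (Z n -` B \<inter> space M) \<omega> \<partial>M)"
        by (rule nn_integral_cong) (simp split: split_indicator)
      also have "\<dots> = emeasure (density M F) (Z n -` B \<inter> space M)"
        by (rule emeasure_density[symmetric]) measurable
      finally show ?thesis .
    qed
    ultimately show "emeasure (distr (density M F) borel (Z n)) B = emeasure (scale_measure d (\<nu> n)) B"
      by (simp add: emeasure_distr d_def mult_ac)
  qed (simp add: sets_\<nu>n)
  then have "(\<integral>\<^sup>+x. f n x \<partial>distr (density M F) borel (Z n)) = d * (\<integral>\<^sup>+x. f n x \<partial>\<nu> n)"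
    by (simp add: nn_integral_scale_measure)
  then show ?case
    by (simp add: nn_integral_distr nn_integral_density F_def d_def mult.assoc)
qed

definition expo :: "real \<Rightarrow> real measure" where
  "expo q = density lborel (\<lambda>x. ennreal (exponential_density q x))"

lemma sets_expo [simp, measurable_cong]: "sets (expo q) = sets borel"
  and space_expo [simp]: "space (expo q) = UNIV"
  by (simp_all add: expo_def)

lemma prob_space_expo: "0 < q \<Longrightarrow> prob_space (expo q)"
  unfolding expo_def by (rule prob_space_exponential_density)

text \<open>The maximum serves thresholds \<open>s < 0\<close>, whose tail is the whole mass: the
  product lemma asks for tails at all real thresholds.\<close>

lemma emeasure_expo_tail:
  assumes q: "0 < q"
  shows "emeasure (expo q) {s<..} = ennreal (exp (- q * max 0 s))"
proof -
  interpret prob_space "expo q" using q by (rule prob_space_expo)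
  have D: "distributed (expo q) lborel (\<lambda>x. x) (exponential_density q)"
    unfolding distributed_def by (auto simp: expo_def distr_id2)
  have pos: "emeasure (expo q) {a<..} = ennreal (exp (- q * a))" if "0 \<le> a" for a
    using exponential_distributedD_gt[OF D that q]
    by (simp add: emeasure_eq_measure greaterThan_def mult.commute)
  show ?thesis
  proof (cases "0 \<le> s")
    case False
    then have "{0<..} \<subseteq> {s<..}" by auto
    then have "emeasure (expo q) {0<..} \<le> emeasure (expo q) {s<..}" by (intro emeasure_mono) simp_all
    with False pos[of 0] emeasure_le_1[of "{s<..}"] show ?thesis by simp
  qed (use pos in auto)
qed

lemma suminf_single: "(\<Sum>z. if w = z then a else (0::ennreal)) = a"
  using sums_unique[OF sums_single[of w "\<lambda>_. a"]] by (simp add: eq_commute cong: if_cong)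

section \<open>The chain and the first consequences of its jump law\<close>

locale evanescent_chain =
  fixes S :: "nat set" and Q :: "nat \<Rightarrow> nat \<Rightarrow> real"
    and P :: "nat \<Rightarrow> 'w measure" and X :: "real \<Rightarrow> 'w \<Rightarrow> nat"
  assumes mc: "markov_chain S Q P X"
    and zero: "0 \<in> S" and nontrivial: "\<exists>c\<in>S. c \<noteq> 0"
    and fin_entry: "finite {i \<in> S. Q i 0 > 0}" and fin_exit: "finite {i \<in> S. Q 0 i > 0}"
    and ne: "non_explosive S P X" and irr: "irreducible_chain S P X" and ev: "evanescent S P X"
begin

abbreviation T :: "nat \<Rightarrow> 'w \<Rightarrow> ereal" where "T n \<omega> \<equiv> jump_time (\<lambda>t. X t \<omega>) n"
abbreviation Y :: "nat \<Rightarrow> 'w \<Rightarrow> nat" where "Y n \<omega> \<equiv> jump_state (\<lambda>t. X t \<omega>) n"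
abbreviation soj :: "nat \<Rightarrow> 'w \<Rightarrow> real" where "soj n \<omega> \<equiv> sojourn (\<lambda>t. X t \<omega>) n"
abbreviation q :: "nat \<Rightarrow> real" where "q \<equiv> exit_rate Q"
abbreviation \<nu> :: "nat \<Rightarrow> real measure" where "\<nu> y \<equiv> expo (q y)"

text \<open>Extended by 0 to targets outside \<open>S\<close>, so that sums over states run over all
  of \<open>nat\<close>.\<close>

definition p :: "nat \<Rightarrow> nat \<Rightarrow> ennreal" where
  "p y z = (if z \<in> S then ennreal (jump_prob Q y z) else 0)"

lemma prob: "i \<in> S \<Longrightarrow> prob_space (P i)"
  and X_measurable: "i \<in> S \<Longrightarrow> 0 \<le> t \<Longrightarrow> X t \<in> measurable (P i) (count_space UNIV)"
  and rc: "i \<in> S \<Longrightarrow> \<omega> \<in> space (P i) \<Longrightarrow> right_cont_path (\<lambda>t. X t \<omega>)"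
  and X_in_S: "i \<in> S \<Longrightarrow> \<omega> \<in> space (P i) \<Longrightarrow> 0 \<le> t \<Longrightarrow> X t \<omega> \<in> S"
  using mc unfolding markov_chain_def right_cont_path_def by auto

lemma Q_nonneg: "i \<in> S \<Longrightarrow> j \<in> S \<Longrightarrow> i \<noteq> j \<Longrightarrow> 0 \<le> Q i j"
  using mc by (auto simp: markov_chain_def Q_matrix_def)

lemma jump_law:
  assumes "i \<in> S" "\<And>k. k \<le> n \<Longrightarrow> y k \<in> S" "\<And>k. k < n \<Longrightarrow> 0 \<le> s k"
  shows "measure (P i) {\<omega> \<in> space (P i). T n \<omega> < \<infinity> \<and> (\<forall>k\<le>n. Y k \<omega> = y k) \<and>
           (\<forall>k<n. T k \<omega> + ereal (s k) < T (Suc k) \<omega>)}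
       = (if y 0 = i then (\<Prod>k<n. jump_prob Q (y k) (y (Suc k)) * exp (- q (y k) * s k)) else 0)"
proof -
  from mc assms(1) have "\<forall>n y s. (\<forall>k\<le>n. y k \<in> S) \<longrightarrow> (\<forall>k<n. (0::real) \<le> s k) \<longrightarrow>
           measure (P i)
             {\<omega> \<in> space (P i). T n \<omega> < \<infinity> \<and> (\<forall>k\<le>n. Y k \<omega> = y k) \<and>
                (\<forall>k<n. T k \<omega> + ereal (s k) < T (Suc k) \<omega>)}
           = (if y 0 = i
              then (\<Prod>k<n. jump_prob Q (y k) (y (Suc k)) * exp (- exit_rate Q (y k) * s k))
              else 0)" by (simp only: markov_chain_def) blast
  then show ?thesis using assms(2,3) by blast
qed

lemma T_measurable: "i \<in> S \<Longrightarrow> T n \<in> borel_measurable (P i)"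
  by (rule measurable_jump_time[OF rc X_measurable])

lemma Y_measurable: "i \<in> S \<Longrightarrow> Y n \<in> measurable (P i) (count_space UNIV)"
  by (rule measurable_jump_state[OF rc X_measurable])

lemma soj_measurable: "i \<in> S \<Longrightarrow> soj n \<in> borel_measurable (P i)"
  unfolding sojourn_def
  by (intro borel_measurable_diff borel_measurable_real_of_ereal T_measurable)

lemma Y_in_S: "i \<in> S \<Longrightarrow> \<omega> \<in> space (P i) \<Longrightarrow> Y n \<omega> \<in> S"
  unfolding jump_state_def by (intro X_in_S real_of_ereal_pos jump_time_nonneg)

lemma AE_start:
  assumes i: "i \<in> S"
  shows "AE \<omega> in P i. X 0 \<omega> = i"
proof -
  interpret prob_space "P i" using i by (rule prob)
  have "measure (P i) {\<omega> \<in> space (P i). T 0 \<omega> < \<infinity> \<and> (\<forall>k\<le>0. Y k \<omega> = i) \<and>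
      (\<forall>k<0. T k \<omega> + ereal 0 < T (Suc k) \<omega>)} = 1"
    using jump_law[of i 0 "\<lambda>_. i" "\<lambda>_. 0"] i by simp
  then have "measure (P i) {\<omega> \<in> space (P i). X 0 \<omega> = i} = 1"
    by (simp add: jump_state_def)
  then show ?thesis by (intro AE_I_eq_1) (use X_measurable[OF i] in \<open>auto simp: emeasure_eq_measure\<close>)
qed

text \<open>For \<open>q y \<le> 0\<close> the jump law gives each possible first jump probability
  at most 0, and countably many pairs of states exhaust the event that a first jump occurs.\<close>

lemma AE_absorbed:
  assumes y: "y \<in> S" and q: "q y \<le> 0"
  shows "AE \<omega> in P y. \<forall>t\<ge>0. X t \<omega> = y"
proof -
  interpret prob_space "P y" using y by (rule prob)
  have "AE \<omega> in P y. \<not> (T 1 \<omega> < \<infinity> \<and> Y 0 \<omega> = a \<and> Y 1 \<omega> = b)" for a b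
  proof (cases "a \<in> S \<and> b \<in> S")
    case True
    define E where "E = {\<omega> \<in> space (P y). T 1 \<omega> < \<infinity> \<and> Y 0 \<omega> = a \<and> Y 1 \<omega> = b}"
    have [measurable]: "T 1 \<in> borel_measurable (P y)" "Y 0 \<in> measurable (P y) (count_space UNIV)"
      "Y 1 \<in> measurable (P y) (count_space UNIV)"
      by (intro T_measurable Y_measurable y)+
    have E: "E \<in> sets (P y)" unfolding E_def by measurable
    \<comment> \<open>With threshold 0 the condition on the holding time is automatic, as jump times
      increase strictly.\<close>
    have "E = {\<omega> \<in> space (P y). T 1 \<omega> < \<infinity> \<and> (\<forall>k\<le>1. Y k \<omega> = (if k = 0 then a else b)) \<and>
           (\<forall>k<1. T k \<omega> + ereal 0 < T (Suc k) \<omega>)}"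
    proof -
      have "T 0 \<omega> < T 1 \<omega>" if "\<omega> \<in> space (P y)" for \<omega>
        using jump_time_less_Suc[OF rc[OF y that], of 0] by simp
      moreover have "k \<le> 1 \<longleftrightarrow> k = 0 \<or> k = 1" for k :: nat by auto
      ultimately show ?thesis unfolding E_def by (auto simp del: jump_time.simps)
    qed
    also have "measure (P y) \<dots> = (if a = y then jump_prob Q a b else 0)"
      using jump_law[of y 1 "\<lambda>k. if k = 0 then a else b" "\<lambda>_. 0"] y True by simp
    also have "\<dots> \<le> 0"
      using q Q_nonneg[of y b] True by (auto simp: jump_prob_def divide_nonneg_nonpos)
    finally have "emeasure (P y) E = 0" by (simp add: emeasure_eq_measure antisym measure_le_0_iff)
    with E have "AE \<omega> in P y. \<omega> \<notin> E" by (intro AE_not_in) (auto simp: null_sets_def)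
    then show ?thesis by (rule AE_mp) (auto simp: E_def intro!: AE_I2)
  next
    case False
    then show ?thesis using Y_in_S[OF y] by (intro AE_I2) blast
  qed
  then have "AE \<omega> in P y. \<forall>a b. \<not> (T 1 \<omega> < \<infinity> \<and> Y 0 \<omega> = a \<and> Y 1 \<omega> = b)"
    unfolding AE_all_countable by blast
  with AE_start[OF y] show ?thesis
  proof eventually_elim
    case (elim \<omega>)
    then have "T (Suc 0) \<omega> = \<infinity>" by (auto simp del: jump_time.simps)
    then show ?case
      using path_between_jumps[of "\<lambda>t. X t \<omega>" 0] elim(1) by (simp add: jump_state_def del: jump_time.simps(2))
  qed
qed

text \<open>An absorbing \<open>y \<noteq> 0\<close> would never lead to 0, against evanescence; an
  absorbing 0 would never lead to a state \<open>c \<noteq> 0\<close>, against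
  irreducibility.\<close>

lemma q_pos:
  assumes y: "y \<in> S"
  shows "0 < q y"
proof (rule ccontr)
  assume "\<not> ?thesis"
  then have AE: "AE \<omega> in P y. \<forall>t\<ge>0. X t \<omega> = y" using AE_absorbed[OF y] by simp
  interpret prob_space "P y" using y by (rule prob)
  show False
  proof (cases "y = 0")
    case False
    then have "AE \<omega> in P y. \<exists>t\<ge>0. X t \<omega> = 0" using ev y by (simp add: evanescent_def)
    with AE have "AE \<omega> in P y. False" by eventually_elim (use False in auto)
    then show False by simp
  next
    case True
    obtain c where c: "c \<in> S" "c \<noteq> 0" using nontrivial by blast
    with irr y True obtain t where t: "0 \<le> t" "measure (P y) {\<omega> \<in> space (P y). X t \<omega> = c} > 0"
      unfolding irreducible_chain_def by blast
    have "measure (P y) {\<omega> \<in> space (P y). X t \<omega> = c} = 0"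
      by (rule measure_eq_0_null_sets, rule null_setsI)
        (use X_measurable[OF y t(1)] AE t c True in \<open>auto intro!: emeasure_eq_0_AE\<close>)
    with t show False by simp
  qed
qed

lemma jump_prob_nonneg: "y \<in> S \<Longrightarrow> z \<in> S \<Longrightarrow> 0 \<le> jump_prob Q y z"
  using Q_nonneg[of y z] q_pos[of y] by (simp add: jump_prob_def)

lemma p_eq: "y \<in> S \<Longrightarrow> z \<in> S \<Longrightarrow> y \<noteq> z \<Longrightarrow> p y z = ennreal (Q y z / q y)"
  by (simp add: p_def jump_prob_def)

text \<open>The off-diagonal entries of the row sum to \<open>q y\<close> because the Q-matrix is
  conservative.\<close>

lemma suminf_p:
  assumes y: "y \<in> S"
  shows "(\<Sum>z. p y z) = 1"
proof -
  have qy: "0 < q y" using y by (rule q_pos)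
  have "((\<lambda>z. Q y z) has_sum 0) S" using mc y by (auto simp: markov_chain_def Q_matrix_def)
  moreover have "((\<lambda>z. Q y z) has_sum Q y y) {y}" by (rule has_sum_finiteI) simp_all
  ultimately have "((\<lambda>z. Q y z) has_sum (0 - Q y y)) (S - {y})"
    using y by (intro has_sum_Diff) simp_all
  then have "((\<lambda>z. Q y z / q y) has_sum (q y / q y)) (S - {y})"
    by (intro has_sum_divide_const) (simp add: exit_rate_def)
  then have "((\<lambda>z. if z \<in> S then jump_prob Q y z else 0) has_sum 1) UNIV"
    using qy by (subst has_sum_cong_neutral[where T="S - {y}" and g="\<lambda>z. Q y z / q y"])
      (auto simp: jump_prob_def)
  then have "(\<lambda>z. if z \<in> S then jump_prob Q y z else 0) sums 1"
    by (rule has_sum_imp_sums)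
  then have "(\<Sum>z. ennreal (if z \<in> S then jump_prob Q y z else 0)) = ennreal 1"
    by (intro suminf_ennreal_eq) (auto simp: jump_prob_nonneg y)
  moreover have "p y = (\<lambda>z. ennreal (if z \<in> S then jump_prob Q y z else 0))"
    by (auto simp: p_def)
  ultimately show ?thesis by simp
qed

text \<open>On the event \<open>A\<close> of one fixed jump path the holding times are independent
  and exponential, with the path probability \<open>c\<close> as total mass. This is the product
  lemma for \<open>P i\<close> restricted to \<open>A\<close>.\<close>

lemma nn_integral_fixed_states:
  assumes i: "i \<in> S" and y: "\<And>k. k \<le> n \<Longrightarrow> y k \<in> S"
    and f: "\<And>k. k < n \<Longrightarrow> f k \<in> borel_measurable borel"
  shows "(\<integral>\<^sup>+\<omega>. indicator {\<omega>. T n \<omega> < \<infinity> \<and> (\<forall>k\<le>n. Y k \<omega> = y k)} \<omega> * (\<Prod>k<n. f k (soj k \<omega>)) \<partial>P i)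
    = (if y 0 = i then \<Prod>k<n. p (y k) (y (Suc k)) * (\<integral>\<^sup>+s. f k s \<partial>\<nu> (y k)) else 0)"
proof -
  interpret prob_space "P i" using i by (rule prob)
  have [measurable]: "\<And>n. T n \<in> borel_measurable (P i)" "\<And>n. Y n \<in> measurable (P i) (count_space UNIV)"
    "\<And>n. soj n \<in> borel_measurable (P i)"
    by (intro T_measurable Y_measurable soj_measurable i)+
  have [measurable]: "f k \<in> borel_measurable borel" if "k < n" for k using that by (rule f)
  define A where "A = {\<omega> \<in> space (P i). T n \<omega> < \<infinity> \<and> (\<forall>k\<le>n. Y k \<omega> = y k)}"
  have A [measurable]: "A \<in> sets (P i)" unfolding A_def by measurable
  define c where "c = (if y 0 = i then \<Prod>k<n. p (y k) (y (Suc k)) else 0)"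
  have "(\<integral>\<^sup>+\<omega>. (\<Prod>k<n. f k (soj k \<omega>)) \<partial>density (P i) (indicator A))
      = c * (\<Prod>k<n. \<integral>\<^sup>+s. f k s \<partial>\<nu> (y k))"
  proof (rule nn_integral_prod_of_tails)
    show "prob_space (\<nu> (y k))" if "k < n" for k using that y q_pos by (simp add: prob_space_expo)
    have "p (y k) (y (Suc k)) \<noteq> \<top>" for k by (simp add: p_def)
    then show "c < \<infinity>" by (auto simp: c_def less_top[symmetric] ennreal_prod_eq_top)
    fix s :: "nat \<Rightarrow> real"
    have "emeasure (density (P i) (indicator A)) {\<omega> \<in> space (density (P i) (indicator A)). \<forall>k<n. s k < soj k \<omega>}
      = emeasure (P i) (A \<inter> {\<omega> \<in> space (P i). \<forall>k<n. s k < soj k \<omega>})"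
      by (simp add: emeasure_restricted)
    also have "A \<inter> {\<omega> \<in> space (P i). \<forall>k<n. s k < soj k \<omega>} =
       {\<omega> \<in> space (P i). T n \<omega> < \<infinity> \<and> (\<forall>k\<le>n. Y k \<omega> = y k) \<and>
           (\<forall>k<n. T k \<omega> + ereal (max 0 (s k)) < T (Suc k) \<omega>)}"
    proof -
      \<comment> \<open>Holding times are positive, so a negative threshold may be replaced by 0,
        where the jump law applies.\<close>
      have "s k < soj k \<omega> \<longleftrightarrow> T k \<omega> + ereal (max 0 (s k)) < T (Suc k) \<omega>"
        if \<omega>: "\<omega> \<in> space (P i)" and fin: "T n \<omega> < \<infinity>" and k: "k < n" for k \<omega>
      proof -
        have fin': "T k \<omega> < \<infinity>" "T (Suc k) \<omega> < \<infinity>"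
          using order_le_less_trans[OF jump_time_mono fin, of k] order_le_less_trans[OF jump_time_mono fin, of "Suc k"] k
          by simp_all
        have "0 < soj k \<omega>" using sojourn_pos[OF rc[OF i \<omega>] fin'(2)] .
        then have "s k < soj k \<omega> \<longleftrightarrow> max 0 (s k) < soj k \<omega>" by auto
        also have "\<dots> \<longleftrightarrow> ereal (real_of_ereal (T k \<omega>)) + ereal (max 0 (s k)) < ereal (real_of_ereal (T (Suc k) \<omega>))"
          by (simp only: sojourn_def plus_ereal.simps less_ereal.simps less_diff_eq add.commute)
        finally show ?thesis by (simp only: jump_time_real fin')
      qed
      then show ?thesis unfolding A_def by blast
    qed
    also have "emeasure (P i) \<dots> =
        ennreal (if y 0 = i then \<Prod>k<n. jump_prob Q (y k) (y (Suc k)) * exp (- q (y k) * max 0 (s k)) else 0)"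
      unfolding emeasure_eq_measure by (subst jump_law) (use i y in auto)
    also have "\<dots> = c * (\<Prod>k<n. emeasure (\<nu> (y k)) {s k<..})"
    proof -
      have "ennreal (\<Prod>k<n. jump_prob Q (y k) (y (Suc k)) * exp (- q (y k) * max 0 (s k)))
        = (\<Prod>k<n. ennreal (jump_prob Q (y k) (y (Suc k)) * exp (- q (y k) * max 0 (s k))))"
        by (rule prod_ennreal[symmetric]) (use y jump_prob_nonneg in auto)
      also have "\<dots> = (\<Prod>k<n. p (y k) (y (Suc k)) * emeasure (\<nu> (y k)) {s k<..})"
        by (rule prod.cong)
          (use y q_pos jump_prob_nonneg in \<open>auto simp: emeasure_expo_tail p_def ennreal_mult\<close>)
      finally show ?thesis by (simp add: c_def prod.distrib)
    qed
    finally show "emeasure (density (P i) (indicator A)) {\<omega> \<in> space (density (P i) (indicator A)). \<forall>k<n. s k < soj k \<omega>}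
      = c * (\<Prod>k<n. emeasure (\<nu> (y k)) {s k<..})" .
  qed (use f in auto)
  also have "(\<integral>\<^sup>+\<omega>. (\<Prod>k<n. f k (soj k \<omega>)) \<partial>density (P i) (indicator A))
      = (\<integral>\<^sup>+\<omega>. indicator A \<omega> * (\<Prod>k<n. f k (soj k \<omega>)) \<partial>P i)"
    by (intro nn_integral_density) measurable
  also have "\<dots> = (\<integral>\<^sup>+\<omega>. indicator {\<omega>. T n \<omega> < \<infinity> \<and> (\<forall>k\<le>n. Y k \<omega> = y k)} \<omega> * (\<Prod>k<n. f k (soj k \<omega>)) \<partial>P i)"
    by (rule nn_integral_cong) (simp add: A_def indicator_def)
  finally show ?thesis by (simp add: c_def prod.distrib)
qed

text \<open>For the chain started in \<open>y\<close> this is the expectation of \<open>\<Prod> (us ! k) Y\<^sub>k S\<^sub>k \<sqdot> r Y\<^sub>n\<close>, with \<open>Y\<close> the jump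
  chain, \<open>S\<close> the holding times and \<open>n\<close> the length of \<open>us\<close>; see \<open>nn_integral_jumps\<close>.\<close>
primrec weight :: "(nat \<Rightarrow> real \<Rightarrow> ennreal) list \<Rightarrow> (nat \<Rightarrow> ennreal) \<Rightarrow> nat \<Rightarrow> ennreal" where
  "weight [] r y = r y"
| "weight (u # us) r y = (\<integral>\<^sup>+s. u y s \<partial>\<nu> y) * (\<Sum>z. p y z * weight us r z)"

lemma weight_append: "weight (us @ vs) r = weight us (weight vs r)"
  by (induction us) (auto simp: fun_eq_iff)

text \<open>The states are summed out from the last to the first: the induction descends from
  \<open>m = n\<close>, where the whole path is fixed, and each step sums over the state with index
  \<open>Suc m\<close>. The restriction to \<open>T n \<omega> < \<infinity>\<close> stays because
  the jump law describes only that event.\<close>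

lemma nn_integral_jumps_prefix:
  assumes i: "i \<in> S" and u: "\<forall>u\<in>set us. \<forall>y. u y \<in> borel_measurable borel"
    and m: "m \<le> n" and n: "n = length us"
  shows "\<And>y. (\<And>k. k \<le> m \<Longrightarrow> y k \<in> S) \<Longrightarrow>
    (\<integral>\<^sup>+\<omega>. indicator {\<omega>. T n \<omega> < \<infinity> \<and> (\<forall>k\<le>m. Y k \<omega> = y k)} \<omega> *
       ((\<Prod>k<n. (us ! k) (Y k \<omega>) (soj k \<omega>)) * r (Y n \<omega>)) \<partial>P i)
    = (if y 0 = i then (\<Prod>k<m. p (y k) (y (Suc k)) * (\<integral>\<^sup>+s. (us ! k) (y k) s \<partial>\<nu> (y k))) *
         weight (drop m us) r (y m) else 0)"
  using m
proof (induction rule: inc_induct)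
  case base
  have "(\<integral>\<^sup>+\<omega>. indicator {\<omega>. T n \<omega> < \<infinity> \<and> (\<forall>k\<le>n. Y k \<omega> = y k)} \<omega> *
       ((\<Prod>k<n. (us ! k) (Y k \<omega>) (soj k \<omega>)) * r (Y n \<omega>)) \<partial>P i)
      = (\<integral>\<^sup>+\<omega>. (indicator {\<omega>. T n \<omega> < \<infinity> \<and> (\<forall>k\<le>n. Y k \<omega> = y k)} \<omega> *
       (\<Prod>k<n. (us ! k) (y k) (soj k \<omega>))) * r (y n) \<partial>P i)"
    by (rule nn_integral_cong) (auto simp: indicator_def mult.assoc)
  also have "\<dots> = (\<integral>\<^sup>+\<omega>. indicator {\<omega>. T n \<omega> < \<infinity> \<and> (\<forall>k\<le>n. Y k \<omega> = y k)} \<omega> *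
       (\<Prod>k<n. (us ! k) (y k) (soj k \<omega>)) \<partial>P i) * r (y n)"
  proof (rule nn_integral_multc)
    have [measurable]: "\<And>n. T n \<in> borel_measurable (P i)" "\<And>n. Y n \<in> measurable (P i) (count_space UNIV)"
      "\<And>n. soj n \<in> borel_measurable (P i)"
      by (intro T_measurable Y_measurable soj_measurable i)+
    have [measurable]: "(us ! k) (y k) \<in> borel_measurable borel" if "k < n" for k
      using u nth_mem[of k us] that n by blast
    have [measurable]: "Measurable.pred (P i) (\<lambda>\<omega>. \<forall>k\<le>n. Y k \<omega> = y k)" by measurable
    show "(\<lambda>\<omega>. indicator {\<omega>. T n \<omega> < \<infinity> \<and> (\<forall>k\<le>n. Y k \<omega> = y k)} \<omega> *
       (\<Prod>k<n. (us ! k) (y k) (soj k \<omega>))) \<in> borel_measurable (P i)" by measurable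
  qed
  also have "\<dots> = (if y 0 = i then \<Prod>k<n. p (y k) (y (Suc k)) * (\<integral>\<^sup>+s. (us ! k) (y k) s \<partial>\<nu> (y k)) else 0) * r (y n)"
    by (subst nn_integral_fixed_states) (use i base u n in auto)
  finally show ?case using n by simp
next
  case (step m)
  define F where "F \<omega> = (\<Prod>k<n. (us ! k) (Y k \<omega>) (soj k \<omega>)) * r (Y n \<omega>)" for \<omega>
  define E where "E = {\<omega>. T n \<omega> < \<infinity> \<and> (\<forall>k\<le>m. Y k \<omega> = y k)}"
  define E' where "E' z = {\<omega>. T n \<omega> < \<infinity> \<and> (\<forall>k\<le>Suc m. Y k \<omega> = (y(Suc m := z)) k)}" for z
  have [measurable]: "\<And>n. T n \<in> borel_measurable (P i)" "\<And>n. Y n \<in> measurable (P i) (count_space UNIV)"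
    "\<And>n. soj n \<in> borel_measurable (P i)"
    by (intro T_measurable Y_measurable soj_measurable i)+
  have "(\<integral>\<^sup>+\<omega>. indicator E \<omega> * F \<omega> \<partial>P i) = (\<integral>\<^sup>+\<omega>. (\<Sum>z. indicator (E' z) \<omega> * F \<omega>) \<partial>P i)"
  proof (rule nn_integral_cong)
    fix \<omega> assume "\<omega> \<in> space (P i)"
    have "indicator (E' z) \<omega> * F \<omega> = (if Y (Suc m) \<omega> = z then indicator E \<omega> * F \<omega> else 0)" for z
      by (auto simp: E_def E'_def indicator_def le_Suc_eq)
    then show "indicator E \<omega> * F \<omega> = (\<Sum>z. indicator (E' z) \<omega> * F \<omega>)"
      by (simp add: suminf_single)
  qed
  also have "\<dots> = (\<Sum>z. \<integral>\<^sup>+\<omega>. indicator (E' z) \<omega> * F \<omega> \<partial>P i)"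
  proof (rule nn_integral_suminf)
    have "(\<lambda>\<omega>. (us ! k) (Y k \<omega>) (soj k \<omega>)) \<in> borel_measurable (P i)" if "k < n" for k
    proof (rule measurable_compose_countable[where f="\<lambda>y \<omega>. (us ! k) y (soj k \<omega>)"])
      show "(\<lambda>\<omega>. (us ! k) y (soj k \<omega>)) \<in> borel_measurable (P i)" for y
        by (rule measurable_compose[OF soj_measurable[OF i]]) (use u nth_mem[of k us] that n in blast)
    qed measurable
    then have [measurable]: "F \<in> borel_measurable (P i)" unfolding F_def by measurable
    have [measurable]: "Measurable.pred (P i) (\<lambda>\<omega>. \<forall>k\<le>Suc m. Y k \<omega> = (y(Suc m := z)) k)" for z by measurable
    show "(\<lambda>\<omega>. indicator (E' z) \<omega> * F \<omega>) \<in> borel_measurable (P i)" for z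
      unfolding E'_def by measurable
  qed
  also have "\<dots> = (\<Sum>z. (if y 0 = i then (\<Prod>k<m. p (y k) (y (Suc k)) * (\<integral>\<^sup>+s. (us ! k) (y k) s \<partial>\<nu> (y k))) *
         (\<integral>\<^sup>+s. (us ! m) (y m) s \<partial>\<nu> (y m)) else 0) * (p (y m) z * weight (drop (Suc m) us) r z))"
  proof (rule suminf_cong)
    fix z
    show "(\<integral>\<^sup>+\<omega>. indicator (E' z) \<omega> * F \<omega> \<partial>P i) =
      (if y 0 = i then (\<Prod>k<m. p (y k) (y (Suc k)) * (\<integral>\<^sup>+s. (us ! k) (y k) s \<partial>\<nu> (y k))) *
         (\<integral>\<^sup>+s. (us ! m) (y m) s \<partial>\<nu> (y m)) else 0) * (p (y m) z * weight (drop (Suc m) us) r z)"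
    proof (cases "z \<in> S")
      case True
      have "(\<integral>\<^sup>+\<omega>. indicator (E' z) \<omega> * F \<omega> \<partial>P i) =
        (if (y(Suc m := z)) 0 = i then (\<Prod>k<Suc m. p ((y(Suc m := z)) k) ((y(Suc m := z)) (Suc k)) *
            (\<integral>\<^sup>+s. (us ! k) ((y(Suc m := z)) k) s \<partial>\<nu> ((y(Suc m := z)) k))) *
         weight (drop (Suc m) us) r ((y(Suc m := z)) (Suc m)) else 0)"
        unfolding E'_def F_def by (rule step.IH) (use step.prems True in \<open>auto simp: le_Suc_eq\<close>)
      also have "(\<Prod>k<Suc m. p ((y(Suc m := z)) k) ((y(Suc m := z)) (Suc k)) *
            (\<integral>\<^sup>+s. (us ! k) ((y(Suc m := z)) k) s \<partial>\<nu> ((y(Suc m := z)) k)))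
          = (\<Prod>k<m. p (y k) (y (Suc k)) * (\<integral>\<^sup>+s. (us ! k) (y k) s \<partial>\<nu> (y k))) *
            (p (y m) z * (\<integral>\<^sup>+s. (us ! m) (y m) s \<partial>\<nu> (y m)))"
        by simp
      finally show ?thesis by (simp add: mult_ac)
    next
      case False
      have "(\<integral>\<^sup>+\<omega>. indicator (E' z) \<omega> * F \<omega> \<partial>P i) = (\<integral>\<^sup>+\<omega>. 0 \<partial>P i)"
        by (rule nn_integral_cong) (use False Y_in_S[OF i, of _ "Suc m"] in \<open>auto simp: E'_def indicator_def\<close>)
      with False show ?thesis by (simp add: p_def)
    qed
  qed
  also have "\<dots> = (if y 0 = i then (\<Prod>k<m. p (y k) (y (Suc k)) * (\<integral>\<^sup>+s. (us ! k) (y k) s \<partial>\<nu> (y k))) *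
         weight (drop m us) r (y m) else 0)"
    using step.hyps n by (simp add: Cons_nth_drop_Suc[symmetric] mult.assoc)
  finally show ?case unfolding E_def F_def .
qed

lemma nn_integral_jumps_defective:
  assumes i: "i \<in> S" and u: "\<forall>u\<in>set us. \<forall>y. u y \<in> borel_measurable borel"
    and n: "n = length us"
  shows "(\<integral>\<^sup>+\<omega>. indicator {\<omega>. T n \<omega> < \<infinity>} \<omega> *
       ((\<Prod>k<n. (us ! k) (Y k \<omega>) (soj k \<omega>)) * r (Y n \<omega>)) \<partial>P i) = weight us r i"
proof -
  have "(\<integral>\<^sup>+\<omega>. indicator {\<omega>. T n \<omega> < \<infinity>} \<omega> *
       ((\<Prod>k<n. (us ! k) (Y k \<omega>) (soj k \<omega>)) * r (Y n \<omega>)) \<partial>P i)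
      = (\<integral>\<^sup>+\<omega>. indicator {\<omega>. T n \<omega> < \<infinity> \<and> (\<forall>k\<le>0. Y k \<omega> = i)} \<omega> *
       ((\<Prod>k<n. (us ! k) (Y k \<omega>) (soj k \<omega>)) * r (Y n \<omega>)) \<partial>P i)"
    using AE_start[OF i]
    by (intro nn_integral_cong_AE, eventually_elim) (simp add: indicator_def jump_state_def)
  also have "\<dots> = weight us r i"
    using nn_integral_jumps_prefix[OF i u _ n, of 0 "\<lambda>_. i" r] i by simp
  finally show ?thesis .
qed

text \<open>With all factors equal to 1 the weight is the total probability of the jump paths of
  length \<open>n\<close>. It is 1 because the rows of \<open>p\<close> sum to 1, so the event that
  \<open>n\<close> jumps occur has full measure.\<close>

lemma AE_T_finite:
  assumes i: "i \<in> S"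
  shows "AE \<omega> in P i. T n \<omega> < \<infinity>"
proof -
  interpret prob_space "P i" using i by (rule prob)
  have [measurable]: "T n \<in> borel_measurable (P i)" using i by (rule T_measurable)
  have one: "weight (replicate n (\<lambda>_ _. 1)) (\<lambda>_. 1) y = 1" if "y \<in> S" for y
    using that
  proof (induction n arbitrary: y)
    case (Suc n)
    interpret expo: prob_space "\<nu> y" using Suc.prems q_pos by (simp add: prob_space_expo)
    have "p y z * weight (replicate n (\<lambda>_ _. 1)) (\<lambda>_. 1) z = p y z" for z
      using Suc.IH[of z] by (cases "z \<in> S") (auto simp: p_def)
    then show ?case using suminf_p[OF Suc.prems] expo.emeasure_space_1 by simp
  qed simp
  have "(\<integral>\<^sup>+\<omega>. indicator {\<omega>. T n \<omega> < \<infinity>} \<omega> \<partial>P i) = 1"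
    using nn_integral_jumps_defective[OF i, of "replicate n (\<lambda>_ _. 1)" n "\<lambda>_. 1"] one[OF i] by simp
  also have "(\<integral>\<^sup>+\<omega>. indicator {\<omega>. T n \<omega> < \<infinity>} \<omega> \<partial>P i) = (\<integral>\<^sup>+\<omega>. indicator {\<omega> \<in> space (P i). T n \<omega> < \<infinity>} \<omega> \<partial>P i)"
    by (rule nn_integral_cong) (simp add: indicator_def)
  also have "\<dots> = emeasure (P i) {\<omega> \<in> space (P i). T n \<omega> < \<infinity>}"
    by (rule nn_integral_indicator) measurable
  finally show ?thesis by (intro AE_I_eq_1) auto
qed

text \<open>The substitute for the Markov property: the path expansions below are choices of the
  factors \<open>us\<close> and of \<open>r\<close>.\<close>

theorem nn_integral_jumps:
  assumes i: "i \<in> S" and u: "\<forall>u\<in>set us. \<forall>y. u y \<in> borel_measurable borel"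
    and n: "n = length us"
  shows "(\<integral>\<^sup>+\<omega>. (\<Prod>k<n. (us ! k) (Y k \<omega>) (soj k \<omega>)) * r (Y n \<omega>) \<partial>P i) = weight us r i"
proof -
  have "(\<integral>\<^sup>+\<omega>. (\<Prod>k<n. (us ! k) (Y k \<omega>) (soj k \<omega>)) * r (Y n \<omega>) \<partial>P i)
    = (\<integral>\<^sup>+\<omega>. indicator {\<omega>. T n \<omega> < \<infinity>} \<omega> *
       ((\<Prod>k<n. (us ! k) (Y k \<omega>) (soj k \<omega>)) * r (Y n \<omega>)) \<partial>P i)"
    using AE_T_finite[OF i, of n]
    by (intro nn_integral_cong_AE, eventually_elim) (simp add: indicator_def)
  with nn_integral_jumps_defective[OF i u n] show ?thesis by simp
qed

lemma AE_regular:
  assumes i: "i \<in> S"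
  shows "AE \<omega> in P i. regular_path (\<lambda>t. X t \<omega>)"
proof -
  have "AE \<omega> in P i. \<forall>n. T n \<omega> < \<infinity>"
    unfolding AE_all_countable using AE_T_finite[OF i] by blast
  moreover have "AE \<omega> in P i. (\<lambda>n. T n \<omega>) \<longlonglongrightarrow> \<infinity>"
    using ne i by (simp add: non_explosive_def)
  moreover have "AE \<omega> in P i. right_cont_path (\<lambda>t. X t \<omega>)" using rc[OF i] by (rule AE_I2)
  ultimately show ?thesis by eventually_elim (simp add: regular_path_def)
qed

end

section \<open>The Green function of the killed chain\<close>

text \<open>The values on \<open>[0,t]\<close> are precisely the jump states up to the index that is
  current at time \<open>t\<close>.\<close>

lemma killed_event_iff:
  assumes reg: "regular_path x" and t: "0 \<le> t"
  shows "x t = j \<and> (\<forall>s\<in>{0..t}. x s \<noteq> 0) \<longleftrightarrow>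
    (\<exists>n. jump_time x n \<le> ereal t \<and> ereal t < jump_time x (Suc n) \<and> jump_state x n = j \<and> (\<forall>k\<le>n. jump_state x k \<noteq> 0))"
    (is "?L \<longleftrightarrow> ?R")
proof
  assume L: ?L
  obtain n where n: "jump_time x n \<le> ereal t" "ereal t < jump_time x (Suc n)"
    using jump_index_regular[OF reg t] by blast
  have "jump_state x k \<noteq> 0" if "k \<le> n" for k
  proof -
    have "jump_time x k \<le> ereal t" using order_trans[OF jump_time_mono[OF that] n(1)] .
    moreover have "0 \<le> real_of_ereal (jump_time x k)" by (intro real_of_ereal_pos jump_time_nonneg)
    moreover have "ereal (real_of_ereal (jump_time x k)) = jump_time x k"
      using reg by (intro jump_time_real) (simp add: regular_path_def)
    ultimately have "real_of_ereal (jump_time x k) \<in> {0..t}"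
      by (metis atLeastAtMost_iff ereal_less_eq(3))
    with L show ?thesis unfolding jump_state_def by blast
  qed
  moreover have "jump_state x n = j" using path_between_jumps[OF n] L by simp
  ultimately show ?R using n by blast
next
  assume ?R
  then obtain n where n: "jump_time x n \<le> ereal t" "ereal t < jump_time x (Suc n)"
    "jump_state x n = j" "\<And>k. k \<le> n \<Longrightarrow> jump_state x k \<noteq> 0" by blast
  have "x s \<noteq> 0" if s: "s \<in> {0..t}" for s
  proof -
    have "ereal s \<le> ereal t" using s by simp
    from order_le_less_trans[OF this n(2)] s
    obtain k where "k < Suc n" "jump_time x k \<le> ereal s" "ereal s < jump_time x (Suc k)"
      using jump_index_exists[of s x "Suc n"] by auto
    with n(4)[of k] path_between_jumps[of x k s] show ?thesis by simp
  qed
  with path_between_jumps[OF n(1,2)] n(3) show ?L by simp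
qed

text \<open>Survival is an uncountable intersection; through the entry time it becomes
  measurable.\<close>

lemma survival_iff_entry_time:
  assumes rc: "right_cont_path x"
  shows "(\<forall>s\<in>{0..t}. x s \<noteq> 0) \<longleftrightarrow> ereal t < entry_time x"
proof
  assume surv: "\<forall>s\<in>{0..t}. x s \<noteq> 0"
  show "ereal t < entry_time x"
  proof (rule ccontr)
    assume le: "\<not> ?thesis"
    then have "entry_time x \<le> ereal t" by simp
    also have "\<dots> < \<infinity>" by simp
    finally have fin: "first_time x 0 {0} < \<infinity>" by (simp add: entry_time_def)
    obtain s where "entry_time x = ereal s" "0 \<le> s" "x s \<in> {0}"
      unfolding entry_time_def using first_time_attained[OF rc order_refl fin] by blast
    moreover from this le have "s \<in> {0..t}" by simp
    ultimately show False using surv by blast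
  qed
next
  assume t: "ereal t < entry_time x"
  show "\<forall>s\<in>{0..t}. x s \<noteq> 0"
  proof (rule ballI, rule notI)
    fix s assume s: "s \<in> {0..t}" "x s = 0"
    then have "entry_time x \<le> ereal s"
      unfolding entry_time_def by (intro first_time_le) (simp_all add: zero_ereal_def)
    with s t have "ereal t < ereal s" by (meson order_less_le_trans)
    with s show False by simp
  qed
qed

lemma sum_sojourn_eq_jump_time: "(\<Sum>k<n. sojourn x k) = real_of_ereal (jump_time x n)"
  using sum_sojourn[of 0 n x] by (simp add: atLeast0LessThan)

section \<open>Exponential integrals over a single holding time\<close>

definition exp_upto :: "real \<Rightarrow> real \<Rightarrow> ennreal" where
  "exp_upto l s = (\<integral>\<^sup>+t. (if 0 \<le> t \<and> t < s then ennreal (exp (l * t)) else 0) \<partial>lborel)"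

lemma exp_upto_measurable [measurable]: "exp_upto l \<in> borel_measurable borel"
  unfolding exp_upto_def by measurable

lemma exp_upto_pos: "0 < s \<Longrightarrow> 0 < exp_upto l s"
proof -
  assume s: "0 < s"
  \<comment> \<open>The minimum bounds the integrand from below whatever the sign of
    \<open>l\<close>.\<close>
  have "0 < ennreal (min 1 (exp (l * s))) * emeasure lborel {0..<s}"
    using s by (simp add: ennreal_zero_less_mult_iff)
  also have "\<dots> = (\<integral>\<^sup>+t. ennreal (min 1 (exp (l * s))) * indicator {0..<s} t \<partial>lborel)"
    by (simp add: nn_integral_cmult_indicator)
  also have "\<dots> \<le> exp_upto l s"
    unfolding exp_upto_def
  proof (rule nn_integral_mono)
    fix t
    have "min 1 (exp (l * s)) \<le> exp (l * t)" if "0 \<le> t" "t < s"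
    proof (cases "0 \<le> l")
      case True
      with that have "1 \<le> exp (l * t)" by simp
      then show ?thesis by (rule min.coboundedI1)
    next
      case False
      with that have "l * s \<le> l * t" by (simp add: mult_left_mono_neg)
      then show ?thesis by (simp add: min.coboundedI2)
    qed
    then show "ennreal (min 1 (exp (l * s))) * indicator {0..<s} t \<le> (if 0 \<le> t \<and> t < s then ennreal (exp (l * t)) else 0)"
      by (auto simp: indicator_def intro!: ennreal_leI)
  qed
  finally show ?thesis .
qed

lemma exp_upto_shift:
  "(\<integral>\<^sup>+t. (if a \<le> t \<and> t < a + s then ennreal (exp (l * t)) else 0) \<partial>lborel) = ennreal (exp (l * a)) * exp_upto l s"
proof -
  have "(\<integral>\<^sup>+t. (if a \<le> t \<and> t < a + s then ennreal (exp (l * t)) else 0) \<partial>lborel)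
     = (\<integral>\<^sup>+t. (if 0 \<le> t \<and> t < s then ennreal (exp (l * (a + t))) else 0) \<partial>lborel)"
    by (subst nn_integral_real_affine[where c=1 and t=a]) (auto intro!: nn_integral_cong)
  also have "\<dots> = (\<integral>\<^sup>+t. ennreal (exp (l * a)) * (if 0 \<le> t \<and> t < s then ennreal (exp (l * t)) else 0) \<partial>lborel)"
    by (rule nn_integral_cong) (simp add: distrib_left exp_add ennreal_mult)
  also have "\<dots> = ennreal (exp (l * a)) * exp_upto l s"
    unfolding exp_upto_def by (rule nn_integral_cmult) measurable
  finally show ?thesis .
qed

text \<open>Equal to \<open>1 / (r - l)\<close> if \<open>l < r\<close>, and infinite otherwise.\<close>
definition lap :: "real \<Rightarrow> real \<Rightarrow> ennreal" where
  "lap l r = (\<integral>\<^sup>+t. (if 0 \<le> t then ennreal (exp (l * t) * exp (- r * t)) else 0) \<partial>lborel)"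

lemma nn_integral_exp_expo:
  assumes r: "0 < r"
  shows "(\<integral>\<^sup>+s. ennreal (exp (l * s)) \<partial>expo r) = ennreal r * lap l r"
proof -
  have "(\<integral>\<^sup>+s. ennreal (exp (l * s)) \<partial>expo r) = (\<integral>\<^sup>+s. ennreal (exponential_density r s) * ennreal (exp (l * s)) \<partial>lborel)"
    unfolding expo_def by (rule nn_integral_density) auto
  also have "\<dots> = (\<integral>\<^sup>+s. ennreal r * (if 0 \<le> s then ennreal (exp (l * s) * exp (- r * s)) else 0) \<partial>lborel)"
    using r by (intro nn_integral_cong) (auto simp: exponential_density_def ennreal_mult[symmetric] mult_ac)
  also have "\<dots> = ennreal r * lap l r"
    unfolding lap_def by (rule nn_integral_cmult) measurable
  finally show ?thesis .
qed

text \<open>By Tonelli this is the integral over \<open>t\<close> of \<open>exp (l * t)\<close>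
  times the tail \<open>exp (- r * t)\<close>. It persists for \<open>r \<le> l\<close>, with both
  sides infinite.\<close>

lemma nn_integral_exp_upto_expo:
  assumes r: "0 < r"
  shows "(\<integral>\<^sup>+s. exp_upto l s \<partial>expo r) = lap l r"
proof -
  interpret expo: prob_space "expo r" using r by (rule prob_space_expo)
  interpret pair_sigma_finite lborel "expo r" ..
  have "(\<integral>\<^sup>+s. exp_upto l s \<partial>expo r) =
      (\<integral>\<^sup>+t. \<integral>\<^sup>+s. (if 0 \<le> t \<and> t < s then ennreal (exp (l * t)) else 0) \<partial>expo r \<partial>lborel)"
    unfolding exp_upto_def by (rule Fubini') measurable
  also have "\<dots> = lap l r"
    unfolding lap_def
  proof (rule nn_integral_cong)
    fix t :: real
    show "(\<integral>\<^sup>+s. (if 0 \<le> t \<and> t < s then ennreal (exp (l * t)) else 0) \<partial>expo r)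
      = (if 0 \<le> t then ennreal (exp (l * t) * exp (- r * t)) else 0)"
    proof (cases "0 \<le> t")
      case True
      have "(\<integral>\<^sup>+s. (if 0 \<le> t \<and> t < s then ennreal (exp (l * t)) else 0) \<partial>expo r)
        = (\<integral>\<^sup>+s. ennreal (exp (l * t)) * indicator {t<..} s \<partial>expo r)"
        using True by (intro nn_integral_cong) (simp add: indicator_def)
      also have "\<dots> = ennreal (exp (l * t)) * emeasure (expo r) {t<..}"
        by (rule nn_integral_cmult_indicator) simp
      finally show ?thesis using True r by (simp add: emeasure_expo_tail ennreal_mult)
    qed simp
  qed
  finally show ?thesis .
qed

lemma lap_pos: "0 < lap l r"
proof -
  \<comment> \<open>The integrand of \<open>lap l r\<close> is \<open>exp ((l - r) * t)\<close>, and
    its integral over \<open>[0,1)\<close> is already positive.\<close>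
  have "0 < exp_upto (l - r) 1" by (rule exp_upto_pos) simp
  also have "\<dots> \<le> lap l r"
    unfolding exp_upto_def lap_def
    by (rule nn_integral_mono) (simp add: left_diff_distrib exp_diff exp_minus field_simps)
  finally show ?thesis .
qed

lemma lap_infinite: "lap r r = \<infinity>"
proof -
  have "of_nat n \<le> lap r r" for n
  proof -
    have "of_nat n = (\<integral>\<^sup>+t. indicator {0..real n} t \<partial>lborel)"
      by (simp add: ennreal_of_nat_eq_real_of_nat)
    also have "\<dots> \<le> lap r r"
      unfolding lap_def by (rule nn_integral_mono) (simp add: indicator_def exp_minus)
    finally show ?thesis .
  qed
  then show ?thesis
    using ennreal_Ex_less_of_nat[of "lap r r"] by (metis infinity_ennreal_def leD less_top)
qed

section \<open>Expansion of the Green function over jump paths\<close>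

context evanescent_chain
begin

text \<open>The value 0 in state 0 implements the killing; the product over \<open>k < n\<close> is
  \<open>exp (l * T\<^sub>n)\<close> on the paths that have avoided 0, see
  \<open>prod_alive_factor\<close>.\<close>

definition alive_factor :: "real \<Rightarrow> nat \<Rightarrow> real \<Rightarrow> ennreal" where
  "alive_factor l y s = (if y = 0 then 0 else ennreal (exp (l * s)))"

lemma weight_alive_factor:
  "y \<in> S \<Longrightarrow> weight (alive_factor l # us) r y =
    (if y = 0 then 0 else ennreal (q y) * lap l (q y) * (\<Sum>z. p y z * weight us r z))"
  by (simp add: alive_factor_def nn_integral_exp_expo q_pos)

text \<open>The contribution of the paths with exactly \<open>n\<close> jumps before time \<open>t\<close> to \<open>killed_integral\<close>.\<close>
definition killed_term :: "real \<Rightarrow> nat \<Rightarrow> nat \<Rightarrow> nat \<Rightarrow> ennreal" where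
  "killed_term l j n = weight (replicate n (alive_factor l) @ [\<lambda>y s. if y = j then exp_upto l s else 0]) (\<lambda>_. 1)"

text \<open>The single factor is followed by one further jump, which sums out to 1.\<close>

lemma killed_term_0: "i \<in> S \<Longrightarrow> killed_term l j 0 i = (if i = j then lap l (q i) else 0)"
  using q_pos[of i] by (cases "i = j") (simp_all add: killed_term_def suminf_p nn_integral_exp_upto_expo)

lemma killed_term_Suc: "i \<in> S \<Longrightarrow> killed_term l j (Suc n) i =
    (if i = 0 then 0 else ennreal (q i) * lap l (q i) * (\<Sum>z. p i z * killed_term l j n z))"
  unfolding killed_term_def by (simp del: weight.simps add: weight_alive_factor)

lemma prod_alive_factor:
  "(\<Prod>k<n. alive_factor l (Y k \<omega>) (soj k \<omega>)) =
    (if \<forall>k<n. Y k \<omega> \<noteq> 0 then ennreal (exp (l * real_of_ereal (T n \<omega>))) else 0)"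
proof (cases "\<forall>k<n. Y k \<omega> \<noteq> 0")
  case True
  then have "(\<Prod>k<n. alive_factor l (Y k \<omega>) (soj k \<omega>)) = (\<Prod>k<n. ennreal (exp (l * soj k \<omega>)))"
    by (intro prod.cong) (auto simp: alive_factor_def)
  also have "\<dots> = ennreal (exp (\<Sum>k<n. l * soj k \<omega>))" by (simp add: prod_ennreal exp_sum)
  finally show ?thesis
    using True by (simp add: sum_distrib_left[symmetric] sum_sojourn_eq_jump_time)
qed (auto simp: alive_factor_def)

text \<open>The integrand is the integral of \<open>exp (l * t)\<close> over the stay in the state
  with index \<open>n\<close>: entering at \<open>T\<^sub>n\<close> gives the factor
  \<open>exp (l * T\<^sub>n)\<close>.\<close>

lemma killed_term_eq:
  assumes i: "i \<in> S"
  shows "killed_term l j n i = (\<integral>\<^sup>+\<omega>. (if Y n \<omega> = j \<and> (\<forall>k<n. Y k \<omega> \<noteq> 0)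
     then ennreal (exp (l * real_of_ereal (T n \<omega>))) * exp_upto l (soj n \<omega>) else 0) \<partial>P i)"
proof -
  let ?us = "replicate n (alive_factor l) @ [\<lambda>y s. if y = j then exp_upto l s else 0]"
  have "killed_term l j n i = (\<integral>\<^sup>+\<omega>. (\<Prod>k<Suc n. (?us ! k) (Y k \<omega>) (soj k \<omega>)) * 1 \<partial>P i)"
    unfolding killed_term_def by (rule nn_integral_jumps[symmetric, OF i])
      (auto simp: alive_factor_def[abs_def] if_distrib intro: measurable_If)
  also have "\<dots> = (\<integral>\<^sup>+\<omega>. (if Y n \<omega> = j \<and> (\<forall>k<n. Y k \<omega> \<noteq> 0)
     then ennreal (exp (l * real_of_ereal (T n \<omega>))) * exp_upto l (soj n \<omega>) else 0) \<partial>P i)"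
  proof (rule nn_integral_cong)
    fix \<omega>
    have *: "(\<Prod>k<n. (?us ! k) (Y k \<omega>) (soj k \<omega>)) = (\<Prod>k<n. alive_factor l (Y k \<omega>) (soj k \<omega>))"
      by (rule prod.cong) (auto simp: nth_append)
    have last: "?us ! n = (\<lambda>y s. if y = j then exp_upto l s else 0)" by (simp add: nth_append)
    show "(\<Prod>k<Suc n. (?us ! k) (Y k \<omega>) (soj k \<omega>)) * 1 = (if Y n \<omega> = j \<and> (\<forall>k<n. Y k \<omega> \<noteq> 0)
     then ennreal (exp (l * real_of_ereal (T n \<omega>))) * exp_upto l (soj n \<omega>) else 0)"
      unfolding prod.lessThan_Suc * last by (auto simp: prod_alive_factor)
  qed
  finally show ?thesis .
qed

lemma entry_time_measurable: "i \<in> S \<Longrightarrow> (\<lambda>\<omega>. entry_time (\<lambda>t. X t \<omega>)) \<in> borel_measurable (P i)"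
  unfolding entry_time_def
proof (rule measurable_first_time[OF rc])
  fix r :: real assume "i \<in> S" "0 \<le> r"
  then have [measurable]: "X r \<in> measurable (P i) (count_space UNIV)" by (rule X_measurable)
  have "Measurable.pred (P i) (\<lambda>\<omega>. X r \<omega> = 0)" by measurable
  then show "Measurable.pred (P i) (\<lambda>\<omega>. X r \<omega> \<in> {0})" by simp
qed auto

text \<open>Almost surely exactly one \<open>n\<close> is current at time \<open>t\<close>, so the
  sum is an indicator. Avoiding 0 at the indices \<open>k < n\<close> suffices because the current
  state is \<open>j \<noteq> 0\<close>.\<close>

lemma killed_semigroup_eq:
  assumes i: "i \<in> S" and j: "j \<noteq> 0" and t: "0 \<le> t"
  shows "ennreal (killed_semigroup P X i j t) =
    (\<integral>\<^sup>+\<omega>. (\<Sum>n. if T n \<omega> \<le> ereal t \<and> ereal t < T (Suc n) \<omega> \<and> Y n \<omega> = j \<and> (\<forall>k<n. Y k \<omega> \<noteq> 0) then 1 else 0) \<partial>P i)"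
proof -
  interpret prob_space "P i" using i by (rule prob)
  define E where "E = {\<omega> \<in> space (P i). X t \<omega> = j \<and> (\<forall>s\<in>{0..t}. X s \<omega> \<noteq> 0)}"
  have [measurable]: "X t \<in> measurable (P i) (count_space UNIV)" using X_measurable[OF i t] .
  note entry_time_measurable[OF i, measurable]
  have "E = {\<omega> \<in> space (P i). X t \<omega> = j \<and> ereal t < entry_time (\<lambda>t. X t \<omega>)}"
    unfolding E_def using survival_iff_entry_time[OF rc[OF i]] by auto
  also have "\<dots> \<in> sets (P i)" by measurable
  finally have [measurable]: "E \<in> sets (P i)" .
  have "ennreal (killed_semigroup P X i j t) = emeasure (P i) E"
    by (simp add: killed_semigroup_def E_def emeasure_eq_measure)
  also have "\<dots> = (\<integral>\<^sup>+\<omega>. indicator E \<omega> \<partial>P i)" by simp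
  also have "\<dots> = (\<integral>\<^sup>+\<omega>. (\<Sum>n. if T n \<omega> \<le> ereal t \<and> ereal t < T (Suc n) \<omega> \<and> Y n \<omega> = j \<and> (\<forall>k<n. Y k \<omega> \<noteq> 0) then 1 else 0) \<partial>P i)"
  proof (rule nn_integral_cong_AE)
    show "AE \<omega> in P i. indicator E \<omega> = (\<Sum>n. if T n \<omega> \<le> ereal t \<and> ereal t < T (Suc n) \<omega> \<and> Y n \<omega> = j \<and> (\<forall>k<n. Y k \<omega> \<noteq> 0) then 1 else (0::ennreal))"
      using AE_regular[OF i] AE_space
    proof eventually_elim
      case (elim \<omega>)
      obtain n where n: "T n \<omega> \<le> ereal t" "ereal t < T (Suc n) \<omega>"
        using jump_index_regular[OF elim(1) t] by blast
      have iff: "T n' \<omega> \<le> ereal t \<and> ereal t < T (Suc n') \<omega> \<longleftrightarrow> n = n'" for n'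
        using n jump_index_unique by blast
      have "(\<forall>k\<le>n. Y k \<omega> \<noteq> 0) \<longleftrightarrow> (\<forall>k<n. Y k \<omega> \<noteq> 0)" if "Y n \<omega> = j"
        using that j by (metis le_less)
      moreover have "\<omega> \<in> E \<longleftrightarrow> (\<exists>n'. n = n' \<and> Y n' \<omega> = j \<and> (\<forall>k\<le>n'. Y k \<omega> \<noteq> 0))"
        using killed_event_iff[OF elim(1) t, of j] iff elim(2) unfolding E_def by blast
      ultimately have "\<omega> \<in> E \<longleftrightarrow> Y n \<omega> = j \<and> (\<forall>k<n. Y k \<omega> \<noteq> 0)" by blast
      moreover have "(if T n' \<omega> \<le> ereal t \<and> ereal t < T (Suc n') \<omega> \<and> Y n' \<omega> = j \<and> (\<forall>k<n'. Y k \<omega> \<noteq> 0) then 1 else 0)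
        = (if n = n' then (if Y n \<omega> = j \<and> (\<forall>k<n. Y k \<omega> \<noteq> 0) then 1 else 0) else (0::ennreal))" for n'
        using iff[of n'] by auto
      ultimately show ?case by (simp add: suminf_single)
    qed
  qed
  finally show ?thesis .
qed

text \<open>Tonelli exchanges sum, expectation and time integral; for fixed \<open>n\<close> the
  latter runs over one holding interval \<open>[a,b)\<close>.\<close>

lemma killed_integral_eq:
  assumes i: "i \<in> S" and j: "j \<noteq> 0"
  shows "killed_integral P X i j l = (\<Sum>n. killed_term l j n i)"
proof -
  interpret prob_space "P i" using i by (rule prob)
  interpret pair_sigma_finite lborel "P i" ..
  have [measurable]: "\<And>n. T n \<in> borel_measurable (P i)" "\<And>n. Y n \<in> measurable (P i) (count_space UNIV)"
    "\<And>n. soj n \<in> borel_measurable (P i)"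
    by (intro T_measurable Y_measurable soj_measurable i)+
  define B where "B n \<omega> \<longleftrightarrow> Y n \<omega> = j \<and> (\<forall>k<n. Y k \<omega> \<noteq> 0)" for n \<omega>
  have [measurable]: "Measurable.pred (P i) (B n)" for n unfolding B_def by measurable
  define h where "h n t \<omega> = (if 0 \<le> t \<and> T n \<omega> \<le> ereal t \<and> ereal t < T (Suc n) \<omega> \<and> B n \<omega> then ennreal (exp (l * t)) else 0)"
    for n t \<omega>
  have h [measurable]: "case_prod (h n) \<in> borel_measurable (lborel \<Otimes>\<^sub>M P i)" for n
    unfolding h_def by measurable
  have "killed_integral P X i j l = (\<integral>\<^sup>+t. \<integral>\<^sup>+\<omega>. (\<Sum>n. h n t \<omega>) \<partial>P i \<partial>lborel)"
    unfolding killed_integral_def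
  proof (rule nn_integral_cong)
    fix t :: real
    show "ennreal (killed_semigroup P X i j t * exp (l * t)) * indicator {0..} t = (\<integral>\<^sup>+\<omega>. (\<Sum>n. h n t \<omega>) \<partial>P i)"
    proof (cases "0 \<le> t")
      case True
      have "ennreal (killed_semigroup P X i j t * exp (l * t)) * indicator {0..} t
        = ennreal (exp (l * t)) * ennreal (killed_semigroup P X i j t)"
        using True by (simp add: killed_semigroup_def ennreal_mult mult.commute)
      also have "\<dots> = (\<integral>\<^sup>+\<omega>. ennreal (exp (l * t)) * (\<Sum>n. if T n \<omega> \<le> ereal t \<and> ereal t < T (Suc n) \<omega> \<and> B n \<omega> then 1 else 0) \<partial>P i)"
        unfolding killed_semigroup_eq[OF i j True] B_def[symmetric]
        by (rule nn_integral_cmult[symmetric]) measurable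
      also have "\<dots> = (\<integral>\<^sup>+\<omega>. (\<Sum>n. h n t \<omega>) \<partial>P i)"
      proof (rule nn_integral_cong)
        fix \<omega>
        have "h n t \<omega> = ennreal (exp (l * t)) * (if T n \<omega> \<le> ereal t \<and> ereal t < T (Suc n) \<omega> \<and> B n \<omega> then 1 else 0)" for n
          using True by (simp add: h_def del: jump_time.simps)
        then show "ennreal (exp (l * t)) * (\<Sum>n. if T n \<omega> \<le> ereal t \<and> ereal t < T (Suc n) \<omega> \<and> B n \<omega> then 1 else 0)
          = (\<Sum>n. h n t \<omega>)"
          by (simp only: ennreal_suminf_cmult)
      qed
      finally show ?thesis .
    qed (simp add: h_def)
  qed
  also have "\<dots> = (\<integral>\<^sup>+t. (\<Sum>n. \<integral>\<^sup>+\<omega>. h n t \<omega> \<partial>P i) \<partial>lborel)"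
    by (intro nn_integral_cong nn_integral_suminf) measurable
  also have "\<dots> = (\<Sum>n. \<integral>\<^sup>+t. \<integral>\<^sup>+\<omega>. h n t \<omega> \<partial>P i \<partial>lborel)"
    by (intro nn_integral_suminf) measurable
  also have "\<dots> = (\<Sum>n. killed_term l j n i)"
  proof (rule suminf_cong)
    fix n
    have "(\<integral>\<^sup>+t. \<integral>\<^sup>+\<omega>. h n t \<omega> \<partial>P i \<partial>lborel) = (\<integral>\<^sup>+\<omega>. \<integral>\<^sup>+t. h n t \<omega> \<partial>lborel \<partial>P i)"
      by (rule Fubini'[symmetric]) (rule h)
    also have "\<dots> = (\<integral>\<^sup>+\<omega>. (if Y n \<omega> = j \<and> (\<forall>k<n. Y k \<omega> \<noteq> 0)
       then ennreal (exp (l * real_of_ereal (T n \<omega>))) * exp_upto l (soj n \<omega>) else 0) \<partial>P i)"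
    proof (rule nn_integral_cong_AE)
      show "AE \<omega> in P i. (\<integral>\<^sup>+t. h n t \<omega> \<partial>lborel) = (if Y n \<omega> = j \<and> (\<forall>k<n. Y k \<omega> \<noteq> 0)
       then ennreal (exp (l * real_of_ereal (T n \<omega>))) * exp_upto l (soj n \<omega>) else 0)"
        using AE_T_finite[OF i, of n] AE_T_finite[OF i, of "Suc n"]
      proof eventually_elim
        case (elim \<omega>)
        define a where "a = real_of_ereal (T n \<omega>)"
        define b where "b = real_of_ereal (T (Suc n) \<omega>)"
        have a: "T n \<omega> = ereal a" and b: "T (Suc n) \<omega> = ereal b"
          using elim by (simp_all add: a_def b_def jump_time_real del: jump_time.simps)
        have a0: "0 \<le> a" unfolding a_def by (intro real_of_ereal_pos jump_time_nonneg)
        have soj: "a + soj n \<omega> = b" unfolding sojourn_def a_def b_def by simp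
        have "h n t \<omega> = (if B n \<omega> then (if a \<le> t \<and> t < a + soj n \<omega> then ennreal (exp (l * t)) else 0) else 0)" for t
          unfolding h_def soj a b using a0 by auto
        then have "(\<integral>\<^sup>+t. h n t \<omega> \<partial>lborel) = (if B n \<omega> then ennreal (exp (l * a)) * exp_upto l (soj n \<omega>) else 0)"
          by (simp add: exp_upto_shift)
        then show ?case unfolding B_def a_def .
      qed
    qed
    also have "\<dots> = killed_term l j n i" by (rule killed_term_eq[OF i, symmetric])
    finally show "(\<integral>\<^sup>+t. \<integral>\<^sup>+\<omega>. h n t \<omega> \<partial>P i \<partial>lborel) = killed_term l j n i" .
  qed
  finally show ?thesis .
qed

end

section \<open>Hitting 0 and the cycle time\<close>

lemma suminf_ge_term: "(f :: nat \<Rightarrow> ennreal) n \<le> suminf f"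
  using sum_le_suminf[of f "{n}"] by simp

lemma suminf_Suc_add: "suminf (f :: nat \<Rightarrow> ennreal) = (\<Sum>n. f (Suc n)) + f 0"
  using suminf_offset[of f 1] by simp

lemma suminf_first_cycle_at:
  assumes "first_cycle_at y N m"
  shows "(\<Sum>N. \<Sum>m. if first_cycle_at y N m then F N m else (0::ennreal)) = F N m"
proof -
  have "first_cycle_at y N' m' \<longleftrightarrow> N = N' \<and> m = m'" for N' m'
    using assms first_cycle_at_unique[of y N m N' m'] by blast
  then have "(if first_cycle_at y N' m' then F N' m' else 0) =
      (if m = m' then (if N = N' then F N m else 0) else 0)" for N' m'
    by simp
  then show ?thesis by (simp only: suminf_single)
qed

lemma suminf_first_hit:
  assumes "\<exists>n. y n = (0::nat)"
  shows "(\<Sum>m. if y m = 0 \<and> (\<forall>k<m. y k \<noteq> 0) then 1 else (0::ennreal)) = 1"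
proof -
  define n where "n = (LEAST n. y n = 0)"
  have "y n = 0" "\<forall>k<n. y k \<noteq> 0"
    unfolding n_def using assms by (auto intro: LeastI dest: not_less_Least)
  then have "(if y m = 0 \<and> (\<forall>k<m. y k \<noteq> 0) then 1 else (0::ennreal)) = (if n = m then 1 else 0)" for m
    by (metis linorder_neqE_nat)
  then show ?thesis by (simp only: suminf_single)
qed

lemma prod_lessThan_add: "(\<Prod>k<a + b. f k) = (\<Prod>k<a. f k) * (\<Prod>k<b. f (a + k))"
  for f :: "nat \<Rightarrow> 'a::comm_monoid_mult"
  by (induction b) (simp_all add: mult.assoc)

section \<open>The hitting time of 0 and its link with the Green function\<close>

context evanescent_chain
begin

lemma alive_factor_measurable: "alive_factor l y \<in> borel_measurable borel"
  unfolding alive_factor_def by simp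

text \<open>\<open>entry_set\<close> and \<open>exit_set\<close> are the sets \<open>N_0\<close> and
  \<open>N_0^*\<close> of the theorem; 0 lies in neither because its diagonal entry is
  negative.\<close>

definition entry_set :: "nat set" where "entry_set = {j \<in> S. Q j 0 > 0}"
definition exit_set :: "nat set" where "exit_set = {z \<in> S. Q 0 z > 0}"

lemma Q_0_0: "Q 0 0 < 0"
  using q_pos[OF zero] by (simp add: exit_rate_def)

lemma entry_set: "finite entry_set" "j \<in> entry_set \<Longrightarrow> j \<in> S \<and> j \<noteq> 0"
  using fin_entry Q_0_0 by (auto simp: entry_set_def intro!: gr0I)

lemma exit_set: "finite exit_set" "z \<in> exit_set \<Longrightarrow> z \<in> S \<and> z \<noteq> 0"
  using fin_exit Q_0_0 by (auto simp: exit_set_def intro!: gr0I)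

lemma q_times_p: "y \<in> S \<Longrightarrow> z \<in> S \<Longrightarrow> y \<noteq> z \<Longrightarrow> ennreal (q y) * p y z = ennreal (Q y z)"
  using q_pos[of y] Q_nonneg[of y z] by (simp add: p_eq ennreal_mult[symmetric])

lemma p_pos_iff: "y \<in> S \<Longrightarrow> 0 < p y z \<longleftrightarrow> z \<in> S \<and> y \<noteq> z \<and> 0 < Q y z"
  using q_pos[of y] by (auto simp: p_def jump_prob_def zero_less_divide_iff)

lemma suminf_exit_set: "(\<Sum>z. p 0 z * f z) = (\<Sum>z\<in>exit_set. p 0 z * f z)"
proof (rule suminf_finite[OF exit_set(1)])
  fix z assume "z \<notin> exit_set"
  with p_pos_iff[OF zero, of z] show "p 0 z * f z = 0"
    by (auto simp: exit_set_def not_gr_zero)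
qed

lemma sum_exit_set: "(\<Sum>z\<in>exit_set. p 0 z) = 1"
  using suminf_exit_set[of "\<lambda>_. 1"] suminf_p[OF zero] by simp

text \<open>For the chain started in the state argument, this is the expectation of the exponential
  of \<open>l\<close> times the hitting time of 0, over the paths that first reach 0 at jump
  \<open>m\<close>.\<close>

definition hit_term :: "real \<Rightarrow> nat \<Rightarrow> nat \<Rightarrow> ennreal" where
  "hit_term l m = weight (replicate m (alive_factor l)) (\<lambda>y. if y = 0 then 1 else 0)"

lemma hit_term_0: "hit_term l 0 i = (if i = 0 then 1 else 0)"
  by (simp add: hit_term_def)

lemma hit_term_Suc: "i \<in> S \<Longrightarrow> hit_term l (Suc m) i =
    (if i = 0 then 0 else ennreal (q i) * lap l (q i) * (\<Sum>z. p i z * hit_term l m z))"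
  unfolding hit_term_def by (simp del: weight.simps(2) add: weight_alive_factor)

lemma killed_term_at_0: "j \<noteq> 0 \<Longrightarrow> killed_term l j n 0 = 0"
  using zero by (cases n) (simp_all add: killed_term_0 killed_term_Suc)

text \<open>Just before reaching 0 the path sits in some \<open>j\<close> of
  \<open>entry_set\<close>. The last holding time and jump contribute
  \<open>q j * lap l (q j) * p j 0\<close>, that is \<open>lap l (q j) * Q j 0\<close>; the first
  factor also ends \<open>killed_term\<close>, so \<open>Q j 0\<close> remains.\<close>

lemma hit_term_eq_killed_term:
  "i \<in> S \<Longrightarrow> hit_term l (Suc m) i = (\<Sum>j\<in>entry_set. killed_term l j m i * ennreal (Q j 0))"
proof (induction m arbitrary: i)
  case 0
  show ?case
  proof (cases "i = 0")
    case True
    then show ?thesis using zero entry_set killed_term_at_0 by (simp add: hit_term_Suc)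
  next
    case False
    have "(\<Sum>z. p i z * hit_term l 0 z) = (\<Sum>z. if 0 = z then p i 0 else 0)"
      by (intro suminf_cong) (simp add: hit_term_0)
    also have "\<dots> = p i 0" by (rule suminf_single)
    finally have "hit_term l (Suc 0) i = lap l (q i) * (ennreal (q i) * p i 0)"
      using False 0 by (simp add: hit_term_Suc mult_ac)
    also have "\<dots> = lap l (q i) * ennreal (Q i 0)"
      using False 0 zero by (simp add: q_times_p)
    also have "\<dots> = (\<Sum>j\<in>entry_set. if i = j then lap l (q i) * ennreal (Q i 0) else 0)"
    proof (cases "i \<in> entry_set")
      case True
      then show ?thesis using entry_set(1) by simp
    next
      case F: False
      then have "ennreal (Q i 0) = 0" using 0 by (simp add: entry_set_def ennreal_eq_0_iff)
      with F show ?thesis using entry_set(1) by simp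
    qed
    also have "\<dots> = (\<Sum>j\<in>entry_set. killed_term l j 0 i * ennreal (Q j 0))"
      using 0 by (intro sum.cong) (auto simp: killed_term_0)
    finally show ?thesis .
  qed
next
  case (Suc m)
  show ?case
  proof (cases "i = 0")
    case True
    then show ?thesis using zero entry_set killed_term_at_0 by (simp add: hit_term_Suc)
  next
    case False
    have "(\<Sum>z. p i z * hit_term l (Suc m) z) = (\<Sum>z. \<Sum>j\<in>entry_set. p i z * killed_term l j m z * ennreal (Q j 0))"
    proof (rule suminf_cong)
      fix z
      show "p i z * hit_term l (Suc m) z = (\<Sum>j\<in>entry_set. p i z * killed_term l j m z * ennreal (Q j 0))"
        using Suc.IH[of z] by (cases "z \<in> S") (auto simp: p_def sum_distrib_left mult.assoc)
    qed
    also have "\<dots> = (\<Sum>j\<in>entry_set. (\<Sum>z. p i z * killed_term l j m z) * ennreal (Q j 0))"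
      by (subst suminf_sum) auto
    finally show ?thesis
      using False Suc.prems by (simp add: hit_term_Suc[of i l "Suc m"] killed_term_Suc sum_distrib_left mult.assoc)
  qed
qed

text \<open>By \<open>killed_integral_eq\<close> this is \<open>killed_integral P X i j l\<close>
  for \<open>i \<in> S\<close> and \<open>j \<noteq> 0\<close>; the target precedes the starting
  state.\<close>

definition green :: "real \<Rightarrow> nat \<Rightarrow> nat \<Rightarrow> ennreal" where
  "green l j i = (\<Sum>n. killed_term l j n i)"

definition hit_mgf :: "real \<Rightarrow> nat \<Rightarrow> ennreal" where
  "hit_mgf l i = (\<Sum>m. hit_term l m i)"

lemma hit_mgf_eq:
  assumes "i \<in> S" "i \<noteq> 0"
  shows "hit_mgf l i = (\<Sum>j\<in>entry_set. green l j i * ennreal (Q j 0))"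
proof -
  have "hit_mgf l i = (\<Sum>m. \<Sum>j\<in>entry_set. killed_term l j m i * ennreal (Q j 0))"
    unfolding hit_mgf_def using assms
    by (subst suminf_Suc_add) (simp add: hit_term_0 hit_term_eq_killed_term)
  also have "\<dots> = (\<Sum>j\<in>entry_set. green l j i * ennreal (Q j 0))"
    unfolding green_def by (subst suminf_sum) auto
  finally show ?thesis .
qed

lemma AE_hits_0:
  assumes i: "i \<in> S"
  shows "AE \<omega> in P i. \<exists>n. Y n \<omega> = 0"
proof -
  have "AE \<omega> in P i. \<exists>t\<ge>0. X t \<omega> = 0"
  proof (cases "i = 0")
    case True
    with AE_start[OF i] show ?thesis by auto
  qed (use ev i in \<open>simp add: evanescent_def\<close>)
  with AE_regular[OF i] show ?thesis
    by eventually_elim (metis regular_path_jump_state)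
qed

text \<open>Without exponential weight the terms are the probabilities of first reaching 0 at jump
  \<open>m\<close>, and 0 is hit almost surely.\<close>

lemma hit_mgf_0:
  assumes i: "i \<in> S"
  shows "hit_mgf 0 i = 1"
proof -
  interpret prob_space "P i" using i by (rule prob)
  have [measurable]: "\<And>n. Y n \<in> measurable (P i) (count_space UNIV)" by (intro Y_measurable i)
  have "hit_term 0 m i = (\<integral>\<^sup>+\<omega>. (if Y m \<omega> = 0 \<and> (\<forall>k<m. Y k \<omega> \<noteq> 0) then 1 else 0) \<partial>P i)" for m
  proof -
    let ?us = "replicate m (alive_factor 0)"
    have "hit_term 0 m i = (\<integral>\<^sup>+\<omega>. (\<Prod>k<m. (?us ! k) (Y k \<omega>) (soj k \<omega>)) * (if Y m \<omega> = 0 then 1 else 0) \<partial>P i)"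
      unfolding hit_term_def by (rule nn_integral_jumps[symmetric, OF i]) (simp_all add: alive_factor_measurable)
    also have "\<dots> = (\<integral>\<^sup>+\<omega>. (if Y m \<omega> = 0 \<and> (\<forall>k<m. Y k \<omega> \<noteq> 0) then 1 else 0) \<partial>P i)"
      by (rule nn_integral_cong) (auto simp: prod_alive_factor)
    finally show ?thesis .
  qed
  then have "hit_mgf 0 i = (\<integral>\<^sup>+\<omega>. (\<Sum>m. if Y m \<omega> = 0 \<and> (\<forall>k<m. Y k \<omega> \<noteq> 0) then 1 else 0) \<partial>P i)"
    unfolding hit_mgf_def by (subst nn_integral_suminf) auto
  also have "\<dots> = (\<integral>\<^sup>+\<omega>. 1 \<partial>P i)"
  proof (rule nn_integral_cong_AE)
    show "AE \<omega> in P i. (\<Sum>m. if Y m \<omega> = 0 \<and> (\<forall>k<m. Y k \<omega> \<noteq> 0) then 1 else (0::ennreal)) = 1"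
      using AE_hits_0[OF i] by eventually_elim (rule suminf_first_hit)
  qed
  finally show ?thesis using emeasure_space_1 by simp
qed

section \<open>Decomposition of the path at its first cycle\<close>

lemma weight_cmult: "weight us (\<lambda>y. c * r y) = (\<lambda>y. c * weight us r y)"
proof (induction us)
  case (Cons u us)
  show ?case
  proof
    fix y
    have "(\<Sum>z. p y z * (c * weight us r z)) = c * (\<Sum>z. p y z * weight us r z)"
      by (simp only: ennreal_suminf_cmult[symmetric] mult.left_commute)
    then show "weight (u # us) (\<lambda>y. c * r y) y = c * weight (u # us) r y"
      by (simp add: Cons mult.left_commute)
  qed
qed simp

text \<open>The contribution to \<open>E[f(H) exp(l R)]\<close> of the paths whose first cycle is at \<open>N\<close>, \<open>m\<close>.\<close>
definition cycle_term :: "(real \<Rightarrow> ennreal) \<Rightarrow> real \<Rightarrow> nat \<Rightarrow> nat \<Rightarrow> nat \<Rightarrow> ennreal" where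
  "cycle_term f l N m = weight (replicate N (alive_factor 0) @
     (\<lambda>y s. if y = 0 then f s else 0) # replicate m (alive_factor l)) (\<lambda>y. if y = 0 then 1 else 0)"

text \<open>A Markov property at 0: the weight of everything from the entry to 0 onward vanishes at
  the other states, so it is a constant times the indicator of 0.\<close>

lemma cycle_term_eq_hit_term:
  "cycle_term f l N m x = (\<integral>\<^sup>+s. f s \<partial>\<nu> 0) * (\<Sum>z. p 0 z * hit_term l m z) * hit_term 0 N x"
proof -
  define c where "c = (\<integral>\<^sup>+s. f s \<partial>\<nu> 0) * (\<Sum>z. p 0 z * hit_term l m z)"
  have "weight ((\<lambda>y s. if y = 0 then f s else 0) # replicate m (alive_factor l)) (\<lambda>y. if y = 0 then 1 else 0)
     = (\<lambda>y. c * (if y = 0 then 1 else 0))"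
    by (auto simp: fun_eq_iff c_def hit_term_def)
  then have "cycle_term f l N m x = c * hit_term 0 N x"
    unfolding cycle_term_def weight_append hit_term_def by (simp only: weight_cmult)
  then show ?thesis by (simp only: c_def)
qed

text \<open>The approach to 0 carries exponent 0 and has total mass 1, so the starting state drops
  out.\<close>

lemma suminf_cycle_term:
  assumes x: "x \<in> S"
  shows "(\<Sum>N. \<Sum>m. cycle_term f l N m x) = (\<integral>\<^sup>+s. f s \<partial>\<nu> 0) * (\<Sum>z\<in>exit_set. p 0 z * hit_mgf l z)"
proof -
  have "(\<Sum>m. \<Sum>z. p 0 z * hit_term l m z) = (\<Sum>z\<in>exit_set. p 0 z * hit_mgf l z)"
    unfolding suminf_exit_set hit_mgf_def by (subst suminf_sum) auto
  moreover have "(\<Sum>N. hit_term 0 N x) = 1" using hit_mgf_0[OF x] by (simp add: hit_mgf_def)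
  ultimately show ?thesis by (simp add: cycle_term_eq_hit_term)
qed

lemma cycle_term_eq:
  assumes x: "x \<in> S" and f: "f \<in> borel_measurable borel"
  shows "cycle_term f l N m x = (\<integral>\<^sup>+\<omega>. (if first_cycle_at (\<lambda>k. Y k \<omega>) N m
     then f (soj N \<omega>) * ennreal (exp (l * (\<Sum>k\<in>{N<..N+m}. soj k \<omega>))) else 0) \<partial>P x)"
proof -
  let ?h = "\<lambda>y s. if y = 0 then f s else 0"
  let ?us = "replicate N (alive_factor 0) @ ?h # replicate m (alive_factor l)"
  have "cycle_term f l N m x = (\<integral>\<^sup>+\<omega>. (\<Prod>k<N + Suc m. (?us ! k) (Y k \<omega>) (soj k \<omega>)) * (if Y (N + Suc m) \<omega> = 0 then 1 else 0) \<partial>P x)"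
    unfolding cycle_term_def by (rule nn_integral_jumps[symmetric, OF x])
      (auto simp: alive_factor_measurable intro: f measurable_If)
  also have "\<dots> = (\<integral>\<^sup>+\<omega>. (if first_cycle_at (\<lambda>k. Y k \<omega>) N m
     then f (soj N \<omega>) * ennreal (exp (l * (\<Sum>k\<in>{N<..N+m}. soj k \<omega>))) else 0) \<partial>P x)"
  proof (rule nn_integral_cong)
    fix \<omega>
    have A: "(\<Prod>k<N. (?us ! k) (Y k \<omega>) (soj k \<omega>)) = (if \<forall>k<N. Y k \<omega> \<noteq> 0 then 1 else 0)"
    proof -
      have "(\<Prod>k<N. (?us ! k) (Y k \<omega>) (soj k \<omega>)) = (\<Prod>k<N. alive_factor 0 (Y k \<omega>) (soj k \<omega>))"
        by (rule prod.cong) (auto simp: nth_append)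
      then show ?thesis by (simp add: prod_alive_factor)
    qed
    have C: "(\<Prod>k<m. (?us ! (N + Suc k)) (Y (N + Suc k) \<omega>) (soj (N + Suc k) \<omega>)) =
       (if \<forall>k<m. Y (N + Suc k) \<omega> \<noteq> 0 then ennreal (exp (l * (\<Sum>k<m. soj (N + Suc k) \<omega>))) else 0)"
    proof -
      have "(\<Prod>k<m. (?us ! (N + Suc k)) (Y (N + Suc k) \<omega>) (soj (N + Suc k) \<omega>)) =
         (\<Prod>k<m. alive_factor l (Y (N + Suc k) \<omega>) (soj (N + Suc k) \<omega>))"
        by (rule prod.cong) (auto simp: nth_append)
      also have "\<dots> = (if \<forall>k<m. Y (N + Suc k) \<omega> \<noteq> 0 then ennreal (exp (l * (\<Sum>k<m. soj (N + Suc k) \<omega>))) else 0)"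
      proof (cases "\<forall>k<m. Y (N + Suc k) \<omega> \<noteq> 0")
        case True
        then have "(\<Prod>k<m. alive_factor l (Y (N + Suc k) \<omega>) (soj (N + Suc k) \<omega>)) =
            (\<Prod>k<m. ennreal (exp (l * soj (N + Suc k) \<omega>)))"
          by (intro prod.cong) (auto simp: alive_factor_def)
        also have "\<dots> = ennreal (exp (l * (\<Sum>k<m. soj (N + Suc k) \<omega>)))"
          by (simp add: prod_ennreal exp_sum[symmetric] sum_distrib_left)
        finally show ?thesis using True by simp
      qed (auto simp: alive_factor_def)
      finally show ?thesis .
    qed
    have B: "?us ! N = ?h" by (simp add: nth_append)
    have idx: "(\<forall>k<m. Y (N + Suc k) \<omega> \<noteq> 0) \<longleftrightarrow> (\<forall>k. N < k \<longrightarrow> k \<le> N + m \<longrightarrow> Y k \<omega> \<noteq> 0)"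
    proof
      assume all: "\<forall>k<m. Y (N + Suc k) \<omega> \<noteq> 0"
      show "\<forall>k. N < k \<longrightarrow> k \<le> N + m \<longrightarrow> Y k \<omega> \<noteq> 0"
      proof (intro allI impI)
        fix k assume "N < k" "k \<le> N + m"
        then have "k - Suc N < m" "N + Suc (k - Suc N) = k" by auto
        with all show "Y k \<omega> \<noteq> 0" by metis
      qed
    qed simp
    have sum: "(\<Sum>k<m. soj (N + Suc k) \<omega>) = (\<Sum>k\<in>{N<..N+m}. soj k \<omega>)"
      by (rule sum.reindex_bij_witness[of _ "\<lambda>k. k - Suc N" "\<lambda>k. N + Suc k"]) auto
    \<comment> \<open>The indices split into the approach \<open>k < N\<close>, the stay in 0 at
      \<open>N\<close>, and the excursion of \<open>m\<close> states.\<close>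
    have prod: "(\<Prod>k<N + Suc m. (?us ! k) (Y k \<omega>) (soj k \<omega>)) =
      (if \<forall>k<N. Y k \<omega> \<noteq> 0 then 1 else 0) * (?h (Y N \<omega>) (soj N \<omega>) *
        (if \<forall>k. N < k \<longrightarrow> k \<le> N + m \<longrightarrow> Y k \<omega> \<noteq> 0 then ennreal (exp (l * (\<Sum>k\<in>{N<..N+m}. soj k \<omega>))) else 0))"
      unfolding prod_lessThan_add A prod.lessThan_Suc_shift C idx sum using B by simp
    show "(\<Prod>k<N + Suc m. (?us ! k) (Y k \<omega>) (soj k \<omega>)) * (if Y (N + Suc m) \<omega> = 0 then 1 else 0) =
      (if first_cycle_at (\<lambda>k. Y k \<omega>) N m then f (soj N \<omega>) * ennreal (exp (l * (\<Sum>k\<in>{N<..N+m}. soj k \<omega>))) else 0)"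
      unfolding prod first_cycle_at_def by auto
  qed
  finally show ?thesis .
qed

lemma first_cycle_at_measurable:
  assumes "x \<in> S"
  shows "Measurable.pred (P x) (\<lambda>\<omega>. first_cycle_at (\<lambda>k. Y k \<omega>) N m)"
proof -
  have [measurable]: "\<And>n. Y n \<in> measurable (P x) (count_space UNIV)" by (intro Y_measurable assms)
  have eq: "first_cycle_at y N m \<longleftrightarrow> (\<forall>k\<in>{..<N}. y k \<noteq> 0) \<and> y N = 0 \<and> (\<forall>k\<in>{N<..N+m}. y k \<noteq> 0) \<and> y (N + m + 1) = 0"
    for y by (auto simp: first_cycle_at_def)
  show ?thesis unfolding eq by measurable
qed

lemma nn_integral_first_cycle:
  assumes x: "x \<in> S" and f: "f \<in> borel_measurable borel"
  shows "(\<integral>\<^sup>+\<omega>. (\<Sum>N. \<Sum>m. if first_cycle_at (\<lambda>k. Y k \<omega>) N m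
     then f (soj N \<omega>) * ennreal (exp (l * (\<Sum>k\<in>{N<..N+m}. soj k \<omega>))) else 0) \<partial>P x)
    = (\<integral>\<^sup>+s. f s \<partial>\<nu> 0) * (\<Sum>z\<in>exit_set. p 0 z * hit_mgf l z)"
proof -
  note f [measurable]
  have [measurable]: "\<And>n. soj n \<in> borel_measurable (P x)" by (intro soj_measurable x)
  note first_cycle_at_measurable[OF x, measurable]
  show ?thesis
    unfolding suminf_cycle_term[OF x, symmetric] cycle_term_eq[OF x f]
    by (subst nn_integral_suminf, measurable)
       (intro suminf_cong nn_integral_suminf, measurable)
qed

text \<open>With \<open>f = 1\<close> and \<open>l = 0\<close> the expected number of pairs
  \<open>N\<close>, \<open>m\<close> that form a first cycle is 1; by uniqueness this is the
  probability that a first cycle exists.\<close>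

lemma AE_first_cycle:
  assumes x: "x \<in> S"
  shows "AE \<omega> in P x. \<exists>N m. first_cycle_at (\<lambda>k. Y k \<omega>) N m"
proof -
  interpret prob_space "P x" using x by (rule prob)
  interpret expo: prob_space "\<nu> 0" by (intro prob_space_expo q_pos zero)
  note first_cycle_at_measurable[OF x, measurable]
  define E where "E = {\<omega> \<in> space (P x). \<exists>N m. first_cycle_at (\<lambda>k. Y k \<omega>) N m}"
  have E: "E \<in> sets (P x)" unfolding E_def by measurable
  have "hit_mgf 0 z = 1" if "z \<in> exit_set" for z using exit_set(2)[OF that] hit_mgf_0 by blast
  then have "1 = (\<integral>\<^sup>+s. 1 \<partial>\<nu> 0) * (\<Sum>z\<in>exit_set. p 0 z * hit_mgf 0 z)"
    using sum_exit_set expo.emeasure_space_1 by simp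
  also have "\<dots> = (\<integral>\<^sup>+\<omega>. (\<Sum>N. \<Sum>m. if first_cycle_at (\<lambda>k. Y k \<omega>) N m then 1 else 0) \<partial>P x)"
    using nn_integral_first_cycle[OF x, of "\<lambda>_. 1" 0] by (simp cong: if_cong)
  also have "\<dots> = (\<integral>\<^sup>+\<omega>. indicator E \<omega> \<partial>P x)"
  proof (rule nn_integral_cong)
    fix \<omega> assume \<omega>: "\<omega> \<in> space (P x)"
    show "(\<Sum>N. \<Sum>m. if first_cycle_at (\<lambda>k. Y k \<omega>) N m then 1 else 0) = (indicator E \<omega> :: ennreal)"
    proof (cases "\<exists>N m. first_cycle_at (\<lambda>k. Y k \<omega>) N m")
      case True
      then obtain N m where "first_cycle_at (\<lambda>k. Y k \<omega>) N m" by blast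
      from suminf_first_cycle_at[OF this, of "\<lambda>_ _. 1"] True \<omega> show ?thesis by (simp add: E_def)
    next
      case False
      then have "\<omega> \<notin> E" by (simp add: E_def)
      with False show ?thesis by simp
    qed
  qed
  also have "\<dots> = emeasure (P x) E" using E by simp
  finally show ?thesis
    by (intro AE_I_eq_1) (use E in \<open>simp_all add: E_def\<close>)
qed

text \<open>\<open>cycle_density\<close> identifies the measure with density \<open>g\<close> on
  \<open>(0,\<infinity>)\<close> with the law of \<open>W\<close> on \<open>H < 1\<close>, and the
  rest is integration against an image measure. The event \<open>E\<close> asks for
  \<open>0 < W < \<infinity>\<close> because the density speaks only of finite positive
  values.\<close>

lemma cycle_mgf_as_expectation:
  assumes x: "x \<in> S" and dens: "cycle_density (P x) X g"
  shows "cycle_mgf g l = (\<integral>\<^sup>+\<omega>. (if holding_time (\<lambda>t. X t \<omega>) < 1 \<and> 0 < cycle_time (\<lambda>t. X t \<omega>) \<and> cycle_time (\<lambda>t. X t \<omega>) < \<infinity>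
     then ennreal (exp (l * real_of_ereal (cycle_time (\<lambda>t. X t \<omega>)))) else 0) \<partial>P x)"
proof -
  define H where "H \<omega> = holding_time (\<lambda>t. X t \<omega>)" for \<omega>
  define W where "W \<omega> = cycle_time (\<lambda>t. X t \<omega>)" for \<omega>
  have g [measurable]: "g \<in> borel_measurable borel"
    and law: "\<And>B. B \<in> sets borel \<Longrightarrow> B \<subseteq> {0<..} \<Longrightarrow> (\<integral>\<^sup>+t\<in>B. ennreal (g t) \<partial>lborel) =
        emeasure (P x) {\<omega> \<in> space (P x). W \<omega> \<in> ereal ` B \<and> H \<omega> < 1}"
    using dens by (auto simp: cycle_density_def H_def W_def)
  have entry [measurable]: "(\<lambda>\<omega>. entry_time (\<lambda>t. X t \<omega>)) \<in> borel_measurable (P x)"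
    by (rule entry_time_measurable[OF x])
  have departure [measurable]: "(\<lambda>\<omega>. departure_time (\<lambda>t. X t \<omega>)) \<in> borel_measurable (P x)"
    unfolding departure_time_def
  proof (rule measurable_first_time[OF rc[OF x] entry])
    show "0 \<le> entry_time (\<lambda>t. X t \<omega>)" for \<omega> unfolding entry_time_def by (rule first_time_ge)
    fix r :: real assume "0 \<le> r"
    then have [measurable]: "X r \<in> measurable (P x) (count_space UNIV)" by (rule X_measurable[OF x])
    have "Measurable.pred (P x) (\<lambda>\<omega>. X r \<omega> \<noteq> 0)" by measurable
    then show "Measurable.pred (P x) (\<lambda>\<omega>. X r \<omega> \<in> - {0})" by simp
  qed
  have [measurable]: "(\<lambda>\<omega>. first_time (\<lambda>t. X t \<omega>) (departure_time (\<lambda>t. X t \<omega>)) {0}) \<in> borel_measurable (P x)"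
  proof (rule measurable_first_time[OF rc[OF x] departure])
    show "0 \<le> departure_time (\<lambda>t. X t \<omega>)" for \<omega>
      unfolding departure_time_def entry_time_def by (meson first_time_ge order_trans)
    fix r :: real assume "0 \<le> r"
    then have [measurable]: "X r \<in> measurable (P x) (count_space UNIV)" by (rule X_measurable[OF x])
    have "Measurable.pred (P x) (\<lambda>\<omega>. X r \<omega> = 0)" by measurable
    then show "Measurable.pred (P x) (\<lambda>\<omega>. X r \<omega> \<in> {0})" by simp
  qed
  have H [measurable]: "H \<in> borel_measurable (P x)" unfolding H_def holding_time_def by measurable
  have W [measurable]: "W \<in> borel_measurable (P x)"
    unfolding W_def cycle_time_def return_time_def holding_time_def by measurable
  define E where "E = {\<omega> \<in> space (P x). H \<omega> < 1 \<and> 0 < W \<omega> \<and> W \<omega> < \<infinity>}"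
  have E [measurable]: "E \<in> sets (P x)" unfolding E_def by measurable
  have distr: "density lborel (\<lambda>t. ennreal (g t) * indicator {0<..} t) =
      distr (density (P x) (indicator E)) borel (\<lambda>\<omega>. real_of_ereal (W \<omega>))"
  proof (rule measure_eqI)
    fix B assume "B \<in> sets (density lborel (\<lambda>t. ennreal (g t) * indicator {0<..} t))"
    then have B [measurable]: "B \<in> sets borel" by simp
    have "emeasure (density lborel (\<lambda>t. ennreal (g t) * indicator {0<..} t)) B
       = (\<integral>\<^sup>+t. ennreal (g t) * indicator {0<..} t * indicator B t \<partial>lborel)"
      by (rule emeasure_density) measurable
    also have "\<dots> = (\<integral>\<^sup>+t\<in>B \<inter> {0<..}. ennreal (g t) \<partial>lborel)"
      by (rule nn_integral_cong) (auto simp: indicator_def)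
    also have "\<dots> = emeasure (P x) {\<omega> \<in> space (P x). W \<omega> \<in> ereal ` (B \<inter> {0<..}) \<and> H \<omega> < 1}"
      by (rule law) auto
    also have "{\<omega> \<in> space (P x). W \<omega> \<in> ereal ` (B \<inter> {0<..}) \<and> H \<omega> < 1}
       = E \<inter> ((\<lambda>\<omega>. real_of_ereal (W \<omega>)) -` B \<inter> space (P x))"
    proof (intro set_eqI)
      fix \<omega>
      show "\<omega> \<in> {\<omega> \<in> space (P x). W \<omega> \<in> ereal ` (B \<inter> {0<..}) \<and> H \<omega> < 1} \<longleftrightarrow>
          \<omega> \<in> E \<inter> ((\<lambda>\<omega>. real_of_ereal (W \<omega>)) -` B \<inter> space (P x))"
        unfolding E_def by (cases "W \<omega>") (auto simp: image_iff)
    qed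
    also have "emeasure (P x) \<dots> = emeasure (distr (density (P x) (indicator E)) borel (\<lambda>\<omega>. real_of_ereal (W \<omega>))) B"
      by (simp add: emeasure_distr emeasure_restricted)
    finally show "emeasure (density lborel (\<lambda>t. ennreal (g t) * indicator {0<..} t)) B =
      emeasure (distr (density (P x) (indicator E)) borel (\<lambda>\<omega>. real_of_ereal (W \<omega>))) B" .
  qed simp
  have "cycle_mgf g l = (\<integral>\<^sup>+t. (ennreal (g t) * indicator {0<..} t) * ennreal (exp (l * t)) \<partial>lborel)"
    unfolding cycle_mgf_def
    by (rule nn_integral_cong) (simp add: ennreal_mult'' indicator_def mult.commute)
  also have "\<dots> = (\<integral>\<^sup>+t. ennreal (exp (l * t)) \<partial>density lborel (\<lambda>t. ennreal (g t) * indicator {0<..} t))"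
    by (rule nn_integral_density[symmetric]) measurable
  also have "\<dots> = (\<integral>\<^sup>+\<omega>. ennreal (exp (l * real_of_ereal (W \<omega>))) \<partial>density (P x) (indicator E))"
    unfolding distr by (rule nn_integral_distr) measurable
  also have "\<dots> = (\<integral>\<^sup>+\<omega>. indicator E \<omega> * ennreal (exp (l * real_of_ereal (W \<omega>))) \<partial>P x)"
    by (rule nn_integral_density) measurable
  also have "\<dots> = (\<integral>\<^sup>+\<omega>. (if H \<omega> < 1 \<and> 0 < W \<omega> \<and> W \<omega> < \<infinity> then ennreal (exp (l * real_of_ereal (W \<omega>))) else 0) \<partial>P x)"
    by (rule nn_integral_cong) (simp add: E_def indicator_def)
  finally show ?thesis unfolding H_def W_def .
qed

text \<open>The factor \<open>h(l)\<close> of the overview.\<close>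

definition holding_mgf :: "real \<Rightarrow> ennreal" where
  "holding_mgf l = (\<integral>\<^sup>+s. (if s < 1 then ennreal (exp (l * s)) else 0) \<partial>\<nu> 0)"

text \<open>On the first cycle \<open>exp (l * W)\<close> splits into \<open>exp (l * H)\<close> and
  \<open>exp (l * R)\<close>; the cut \<open>H < 1\<close> concerns only the first of them, which
  becomes the \<open>f\<close> of the path expansion.\<close>

lemma cycle_mgf_eq:
  assumes x: "x \<in> S" and dens: "cycle_density (P x) X g"
  shows "cycle_mgf g l = holding_mgf l * (\<Sum>z\<in>exit_set. p 0 z * hit_mgf l z)"
proof -
  let ?f = "\<lambda>s. if s < 1 then ennreal (exp (l * s)) else 0"
  have "cycle_mgf g l = (\<integral>\<^sup>+\<omega>. (\<Sum>N. \<Sum>m. if first_cycle_at (\<lambda>k. Y k \<omega>) N m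
     then ?f (soj N \<omega>) * ennreal (exp (l * (\<Sum>k\<in>{N<..N+m}. soj k \<omega>))) else 0) \<partial>P x)"
    unfolding cycle_mgf_as_expectation[OF assms]
  proof (rule nn_integral_cong_AE)
    show "AE \<omega> in P x. (if holding_time (\<lambda>t. X t \<omega>) < 1 \<and> 0 < cycle_time (\<lambda>t. X t \<omega>) \<and> cycle_time (\<lambda>t. X t \<omega>) < \<infinity>
       then ennreal (exp (l * real_of_ereal (cycle_time (\<lambda>t. X t \<omega>)))) else 0) =
      (\<Sum>N. \<Sum>m. if first_cycle_at (\<lambda>k. Y k \<omega>) N m
         then ?f (soj N \<omega>) * ennreal (exp (l * (\<Sum>k\<in>{N<..N+m}. soj k \<omega>))) else 0)"
      using AE_first_cycle[OF x] AE_regular[OF x]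
    proof eventually_elim
      case (elim \<omega>)
      then obtain N m where cyc: "first_cycle_at (\<lambda>k. Y k \<omega>) N m" by blast
      note times = first_cycle_at_times[OF elim(2) cyc]
      have "{N..N+m} = insert N {N<..N+m}" by auto
      then have sum: "(\<Sum>k\<in>{N..N+m}. soj k \<omega>) = soj N \<omega> + (\<Sum>k\<in>{N<..N+m}. soj k \<omega>)" by simp
      have "(if holding_time (\<lambda>t. X t \<omega>) < 1 \<and> 0 < cycle_time (\<lambda>t. X t \<omega>) \<and> cycle_time (\<lambda>t. X t \<omega>) < \<infinity>
        then ennreal (exp (l * real_of_ereal (cycle_time (\<lambda>t. X t \<omega>)))) else 0)
        = (if soj N \<omega> < 1 then ennreal (exp (l * (\<Sum>k\<in>{N..N+m}. soj k \<omega>))) else 0)"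
        using times(3) unfolding times(1,2) by simp
      also have "\<dots> = ?f (soj N \<omega>) * ennreal (exp (l * (\<Sum>k\<in>{N<..N+m}. soj k \<omega>)))"
        unfolding sum by (simp add: distrib_left exp_add ennreal_mult)
      finally show ?case
        using suminf_first_cycle_at[OF cyc, of "\<lambda>N m. ?f (soj N \<omega>) * ennreal (exp (l * (\<Sum>k\<in>{N<..N+m}. soj k \<omega>)))"]
        by simp
    qed
  qed
  also have "\<dots> = (\<integral>\<^sup>+s. ?f s \<partial>\<nu> 0) * (\<Sum>z\<in>exit_set. p 0 z * hit_mgf l z)"
    by (rule nn_integral_first_cycle[OF x]) measurable
  finally show ?thesis by (simp add: holding_mgf_def)
qed

end

section \<open>The power series of the moment generating function\<close>

text \<open>Tonelli for the exponential series; \<open>l \<ge> 0\<close> keeps all terms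
  nonnegative.\<close>

lemma cycle_mgf_power_series:
  assumes g: "g \<in> borel_measurable borel" and l: "0 \<le> l"
  shows "cycle_mgf g l = (\<Sum>k. ennreal (l ^ k / fact k) * (\<integral>\<^sup>+t\<in>{0<..}. ennreal (t ^ k * g t) \<partial>lborel))"
proof -
  note g [measurable]
  have "cycle_mgf g l = (\<integral>\<^sup>+t. (\<Sum>k. ennreal (l ^ k / fact k) * (ennreal (t ^ k * g t) * indicator {0<..} t)) \<partial>lborel)"
    unfolding cycle_mgf_def
  proof (rule nn_integral_cong)
    fix t :: real
    show "ennreal (exp (l * t) * g t) * indicator {0<..} t =
      (\<Sum>k. ennreal (l ^ k / fact k) * (ennreal (t ^ k * g t) * indicator {0<..} t))"
    proof (cases "0 < t")
      case True
      have "ennreal (exp (l * t) * g t) = ennreal (exp (l * t)) * ennreal (g t)" by (rule ennreal_mult') simp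
      also have "ennreal (exp (l * t)) = (\<Sum>k. ennreal ((l * t) ^ k / fact k))"
        using exp_converges[of "l * t"] True l
        by (intro suminf_ennreal_eq[symmetric]) (auto simp: divide_inverse_commute)
      also have "\<dots> * ennreal (g t) = (\<Sum>k. ennreal ((l * t) ^ k / fact k) * ennreal (g t))"
        by (rule ennreal_suminf_multc[symmetric])
      also have "\<dots> = (\<Sum>k. ennreal (l ^ k / fact k) * ennreal (t ^ k * g t))"
        using True l
        by (intro suminf_cong) (simp add: ennreal_mult' power_mult_distrib mult.assoc flip: times_divide_eq_left)
      finally show ?thesis using True by simp
    qed simp
  qed
  also have "\<dots> = (\<Sum>k. \<integral>\<^sup>+t. ennreal (l ^ k / fact k) * (ennreal (t ^ k * g t) * indicator {0<..} t) \<partial>lborel)"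
    by (rule nn_integral_suminf) measurable
  also have "\<dots> = (\<Sum>k. ennreal (l ^ k / fact k) * (\<integral>\<^sup>+t\<in>{0<..}. ennreal (t ^ k * g t) \<partial>lborel))"
    by (intro suminf_cong nn_integral_cmult) measurable
  finally show ?thesis .
qed

lemma cycle_mgf_level_one:
  assumes g: "g \<in> borel_measurable borel"
    and a: "0 < a" and fin: "\<And>l. 0 \<le> l \<Longrightarrow> l < a \<Longrightarrow> cycle_mgf g l < \<infinity>"
    and at_a: "cycle_mgf g a = \<infinity>" and at_0: "cycle_mgf g 0 < 1"
  shows "\<exists>\<phi>. cycle_mgf g \<phi> = 1 \<and> finite_left_derivative (cycle_mgf g) \<phi>"
proof -
  define m where "m k = (\<integral>\<^sup>+t\<in>{0<..}. ennreal (t ^ k * g t) \<partial>lborel)" for k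
  have series: "cycle_mgf g l = (\<Sum>k. ennreal (l ^ k / fact k) * m k)" if "0 \<le> l" for l
    unfolding m_def by (rule cycle_mgf_power_series[OF g that])
  have m_fin: "m k < \<infinity>" for k
  proof -
    \<comment> \<open>Any point of \<open>(0,a)\<close> would do in place of \<open>a / 2\<close>: a
      moment is at most a multiple of the finite value of the series there.\<close>
    have "ennreal ((a / 2) ^ k / fact k) * m k \<le> cycle_mgf g (a / 2)"
      unfolding series[of "a / 2", OF less_imp_le[OF half_gt_zero[OF a]]]
      using sum_le_suminf[of "\<lambda>k. ennreal ((a / 2) ^ k / fact k) * m k" "{k}"] by simp
    also have "\<dots> < \<infinity>" using a by (intro fin) auto
    finally have "ennreal ((a / 2) ^ k / fact k) * m k < \<infinity>" .
    moreover have "0 < ennreal ((a / 2) ^ k / fact k)" using a by simp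
    ultimately show ?thesis using a by (auto simp: ennreal_mult_less_top)
  qed
  define c where "c k = enn2real (m k) / fact k" for k
  have c0: "0 \<le> c k" for k by (simp add: c_def)
  have monomial: "ennreal (l ^ k / fact k) * m k = ennreal (c k * l ^ k)" if "0 \<le> l" for k l
  proof -
    have "m k = ennreal (enn2real (m k))" using m_fin[of k] by simp
    then show ?thesis using that by (metis (no_types, lifting) c_def ennreal_mult' fact_ge_zero mult.commute divide_nonneg_nonneg times_divide_eq_left zero_le_power)
  qed
  have ser: "cycle_mgf g l = (\<Sum>k. ennreal (c k * l ^ k))" if "0 \<le> l" for l
    using series[OF that] monomial[OF that] by simp
  have summable: "summable (\<lambda>k. c k * l ^ k)" if "0 \<le> l" "l < a" for l
  proof (rule summable_suminf_not_top)
    show "0 \<le> c k * l ^ k" for k using c0 that by simp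
    show "(\<Sum>k. ennreal (c k * l ^ k)) \<noteq> \<top>" using fin[OF that] ser[OF that(1)] by simp
  qed
  define F where "F l = (\<Sum>k. c k * l ^ k)" for l :: real
  have F0: "0 \<le> F l" if "0 \<le> l" "l < a" for l
    unfolding F_def by (intro suminf_nonneg summable that mult_nonneg_nonneg c0 zero_le_power)
  have mgf_F: "cycle_mgf g l = ennreal (F l)" if "0 \<le> l" "l < a" for l
    unfolding ser[OF that(1)] F_def
    by (rule suminf_ennreal2) (use c0 that summable in auto)
  have deriv: "\<exists>D. (F has_field_derivative D) (at l)" if "\<bar>l\<bar> < a" for l
  proof -
    \<comment> \<open>A point of convergence strictly beyond \<open>l\<close>, which permits
      termwise differentiation at \<open>l\<close>.\<close>
    define K where "K = (\<bar>l\<bar> + a) / 2"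
    have "0 \<le> K" "K < a" "norm l < norm K" using that by (auto simp: K_def)
    then show ?thesis
      unfolding F_def using termdiffs_strong[OF summable[of K], of l] by blast
  qed
  \<comment> \<open>If \<open>F\<close> stayed at most 1 below \<open>a\<close>, then by continuity
    each partial sum would be at most 1 at \<open>a\<close>, and so would the whole series, which is
    infinite there.\<close>
  obtain b where b: "0 \<le> b" "b < a" "1 < F b"
  proof (rule ccontr)
    assume "\<not> thesis"
    with that have le1: "F b \<le> 1" if "0 \<le> b" "b < a" for b using that by force
    have "(\<Sum>k<n. c k * a ^ k) \<le> 1" for n
    proof (rule tendsto_upperbound)
      show "((\<lambda>b. \<Sum>k<n. c k * b ^ k) \<longlongrightarrow> (\<Sum>k<n. c k * a ^ k)) (at_left a)"
        by (intro tendsto_intros)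
      have "\<forall>\<^sub>F b in at_left a. b \<in> {0<..<a}" by (rule eventually_at_left_real[OF a])
      then show "\<forall>\<^sub>F b in at_left a. (\<Sum>k<n. c k * b ^ k) \<le> 1"
      proof eventually_elim
        case (elim b)
        then have "(\<Sum>k<n. c k * b ^ k) \<le> F b"
          unfolding F_def by (intro sum_le_suminf summable) (auto simp: c0)
        with le1[of b] elim show ?case by simp
      qed
    qed simp
    then have "(\<Sum>k<n. ennreal (c k * a ^ k)) \<le> 1" for n
      using c0 a by (simp add: sum_ennreal)
    then have "(\<Sum>k. ennreal (c k * a ^ k)) \<le> 1"
      by (intro suminf_le_const) auto
    with at_a ser[of a] a show False by (simp add: top_unique)
  qed
  have "F 0 < 1" using at_0 mgf_F[of 0] a F0[of 0] by (simp add: ennreal_less_one_iff)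
  moreover have "continuous_on {0..b} F"
  proof (intro continuous_at_imp_continuous_on ballI)
    fix l assume "l \<in> {0..b}"
    with b deriv[of l] show "isCont F l" by (auto intro: DERIV_isCont)
  qed
  ultimately obtain \<phi> where \<phi>: "0 \<le> \<phi>" "\<phi> \<le> b" "F \<phi> = 1"
    using IVT'[of F 0 1 b] b by auto
  \<comment> \<open>With \<phi> inside \<open>(0,a)\<close>, the moment generating function agrees
    with \<open>F\<close> on a neighbourhood of \<phi> and inherits its derivative.\<close>
  have \<phi>0: "0 < \<phi>" using \<phi> \<open>F 0 < 1\<close> by (metis less_irrefl order_le_less)
  have \<phi>a: "\<phi> < a" using \<phi> b by simp
  obtain D where D: "(F has_field_derivative D) (at \<phi>)" using deriv[of \<phi>] \<phi>0 \<phi>a by auto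
  have "((\<lambda>l. enn2real (cycle_mgf g l)) has_real_derivative D) (at \<phi>)"
    by (rule has_field_derivative_transform_within_open[OF D, of "{0<..<a}"])
      (use \<phi>0 \<phi>a mgf_F F0 in auto)
  then have "((\<lambda>l. enn2real (cycle_mgf g l)) has_real_derivative D) (at_left \<phi>)"
    by (rule has_field_derivative_at_within)
  moreover have "\<forall>\<^sub>F l in at_left \<phi>. l \<in> {0<..<\<phi>}" by (rule eventually_at_left_real[OF \<phi>0])
  then have "\<forall>\<^sub>F l in at_left \<phi>. cycle_mgf g l < \<infinity>"
    by eventually_elim (use fin \<phi>a in auto)
  ultimately have "finite_left_derivative (cycle_mgf g) \<phi>"
    unfolding finite_left_derivative_def using fin[of \<phi>] \<phi> \<phi>a by auto
  moreover have "cycle_mgf g \<phi> = 1" using mgf_F[of \<phi>] \<phi> \<phi>a by simp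
  ultimately show ?thesis by blast
qed

section \<open>Solidarity and the value 1\<close>

context evanescent_chain
begin

text \<open>First-step bound: a jump from \<open>i\<close> to \<open>z\<close> followed by a path
  from \<open>z\<close> is a path from \<open>i\<close>. The factor \<open>c\<close> is infinite for
  \<open>q i \<le> l\<close>; the argument uses only that it is positive.\<close>

lemma green_forward:
  assumes i: "i \<in> S" "i \<noteq> 0" and edge: "z \<in> S" "i \<noteq> z" "0 < Q i z" and fin: "green l j i < \<infinity>"
  shows "green l j z < \<infinity>"
proof -
  define c where "c = ennreal (q i) * lap l (q i)"
  have "c * p i z * green l j z = (\<Sum>n. c * (p i z * killed_term l j n z))"
    unfolding green_def by (simp add: mult.assoc)
  also have "\<dots> \<le> (\<Sum>n. killed_term l j (Suc n) i)"
  proof (rule suminf_le)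
    fix n
    have "c * (p i z * killed_term l j n z) \<le> c * (\<Sum>z. p i z * killed_term l j n z)"
      by (intro mult_left_mono suminf_ge_term) simp
    then show "c * (p i z * killed_term l j n z) \<le> killed_term l j (Suc n) i"
      using i by (simp add: killed_term_Suc c_def)
  qed auto
  also have "\<dots> \<le> green l j i" unfolding green_def by (subst (2) suminf_Suc_add) simp
  also note fin
  finally have "c * p i z * green l j z < \<infinity>" .
  moreover have "0 < c * p i z"
    using q_pos[OF i(1)] lap_pos[of l "q i"] p_pos_iff[OF i(1), of z] edge
    by (simp add: c_def ennreal_zero_less_mult_iff)
  ultimately show ?thesis by (auto simp: ennreal_mult_less_top)
qed

text \<open>Last-step counterpart: a path ending in \<open>j'\<close> is extended by a jump to
  \<open>j\<close> and a stay there. The stay in \<open>j'\<close> gains the factor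
  \<open>q j'\<close>, which with \<open>p j' j\<close> makes \<open>Q j' j\<close>. The induction
  peels off the first state, since weights recurse from the front.\<close>

lemma killed_term_extend:
  assumes j: "j' \<in> S" "j' \<noteq> 0" "j \<in> S" "j' \<noteq> j" and i: "i \<in> S"
  shows "killed_term l j' n i * (ennreal (Q j' j) * lap l (q j)) \<le> killed_term l j (Suc n) i"
  using i
proof (induction n arbitrary: i)
  case 0
  show ?case
  proof (cases "i = j'")
    case True
    have "lap l (q j') * (ennreal (Q j' j) * lap l (q j)) = ennreal (q j') * lap l (q j') * (p j' j * killed_term l j 0 j)"
      using j by (simp add: q_times_p[symmetric] killed_term_0 mult_ac)
    also have "\<dots> \<le> ennreal (q j') * lap l (q j') * (\<Sum>z. p j' z * killed_term l j 0 z)"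
      by (intro mult_left_mono suminf_ge_term) simp
    finally show ?thesis using True j by (simp add: killed_term_0[of j'] killed_term_Suc[of j'])
  qed (use 0 in \<open>simp add: killed_term_0\<close>)
next
  case (Suc n)
  define c where "c = ennreal (Q j' j) * lap l (q j)"
  show ?case
  proof (cases "i = 0")
    case False
    have "(\<Sum>z. p i z * killed_term l j' n z) * c = (\<Sum>z. p i z * (killed_term l j' n z * c))"
      by (simp flip: ennreal_suminf_multc mult.assoc)
    also have "\<dots> \<le> (\<Sum>z. p i z * killed_term l j (Suc n) z)"
    proof (rule suminf_le)
      show "p i z * (killed_term l j' n z * c) \<le> p i z * killed_term l j (Suc n) z" for z
        using Suc.IH[of z] by (cases "z \<in> S") (auto simp: p_def c_def intro: mult_left_mono)
    qed auto
    finally have "ennreal (q i) * lap l (q i) * ((\<Sum>z. p i z * killed_term l j' n z) * c)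
        \<le> ennreal (q i) * lap l (q i) * (\<Sum>z. p i z * killed_term l j (Suc n) z)"
      by (rule mult_left_mono) simp
    then show ?thesis
      using False Suc.prems by (simp add: killed_term_Suc[of i l j' n] killed_term_Suc[of i l j "Suc n"] c_def mult.assoc)
  qed (use Suc.prems in \<open>simp add: killed_term_Suc\<close>)
qed

lemma green_backward:
  assumes j: "j' \<in> S" "j' \<noteq> 0" "j \<in> S" "j' \<noteq> j" "0 < Q j' j" and i: "i \<in> S" and fin: "green l j i < \<infinity>"
  shows "green l j' i < \<infinity>"
proof -
  define c where "c = ennreal (Q j' j) * lap l (q j)"
  have "green l j' i * c = (\<Sum>n. killed_term l j' n i * c)"
    unfolding green_def by simp
  also have "\<dots> \<le> (\<Sum>n. killed_term l j (Suc n) i)"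
    unfolding c_def by (intro suminf_le killed_term_extend j i) auto
  also have "\<dots> \<le> green l j i" unfolding green_def by (subst (2) suminf_Suc_add) simp
  also note fin
  finally have "green l j' i * c < \<infinity>" .
  moreover have "0 < c"
    using j lap_pos[of l "q j"] by (simp add: c_def ennreal_zero_less_mult_iff)
  ultimately show ?thesis by (auto simp: ennreal_mult_less_top)
qed

definition edges :: "(nat \<times> nat) set" where
  "edges = {(y, z). y \<in> S \<and> y \<noteq> 0 \<and> z \<in> S \<and> z \<noteq> 0 \<and> y \<noteq> z \<and> 0 < Q y z}"

text \<open>A positive sum has a positive summand, whose first jump is an edge; paths through 0
  contribute nothing.\<close>

lemma edges_of_killed_term:
  assumes "0 < killed_term l j n i" "i \<in> S" "i \<noteq> 0" "j \<noteq> 0"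
  shows "(i, j) \<in> edges\<^sup>*"
  using assms
proof (induction n arbitrary: i)
  case 0
  then show ?case by (simp add: killed_term_0 split: if_splits)
next
  case (Suc n)
  then have "0 < (\<Sum>z. p i z * killed_term l j n z)"
    by (simp add: killed_term_Suc ennreal_zero_less_mult_iff)
  then have "(\<Sum>z. p i z * killed_term l j n z) \<noteq> 0" by simp
  moreover have "(\<Sum>z. p i z * killed_term l j n z) = 0" if "\<And>z. p i z * killed_term l j n z = 0"
    by (simp only: that suminf_zero)
  ultimately obtain z where "p i z * killed_term l j n z \<noteq> 0" by blast
  then have z: "0 < p i z" "0 < killed_term l j n z" by (simp_all add: zero_less_iff_neq_zero)
  have z0: "z \<noteq> 0" using z(2) killed_term_at_0[OF Suc.prems(4)] by (cases "z = 0") simp_all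
  have zS: "z \<in> S" "i \<noteq> z" "0 < Q i z" using z(1) p_pos_iff[OF Suc.prems(2)] by simp_all
  then have "(i, z) \<in> edges" using Suc.prems z0 by (simp add: edges_def)
  moreover have "(z, j) \<in> edges\<^sup>*" by (rule Suc.IH[OF z(2) zS(1) z0 Suc.prems(4)])
  ultimately show ?case by (rule converse_rtrancl_into_rtrancl)
qed

text \<open>If all terms vanished, the jump chain would almost surely not visit \<open>j\<close>
  before 0, and the killed semigroup would vanish at all times, against irreducibility on
  \<open>C\<close>.\<close>

lemma killed_term_pos_exists:
  assumes i: "i \<in> S" "i \<noteq> 0" and j: "j \<in> S" "j \<noteq> 0"
  shows "\<exists>n. 0 < killed_term l j n i"
proof (rule ccontr)
  assume none: "\<not> ?thesis"
  interpret prob_space "P i" using i(1) by (rule prob)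
  have [measurable]: "\<And>n. T n \<in> borel_measurable (P i)" "\<And>n. Y n \<in> measurable (P i) (count_space UNIV)"
    "\<And>n. soj n \<in> borel_measurable (P i)"
    by (intro T_measurable Y_measurable soj_measurable i)+
  have "AE \<omega> in P i. \<not> (Y n \<omega> = j \<and> (\<forall>k<n. Y k \<omega> \<noteq> 0))" for n
  proof -
    have "(\<integral>\<^sup>+\<omega>. (if Y n \<omega> = j \<and> (\<forall>k<n. Y k \<omega> \<noteq> 0)
     then ennreal (exp (l * real_of_ereal (T n \<omega>))) * exp_upto l (soj n \<omega>) else 0) \<partial>P i) = 0"
      using none killed_term_eq[OF i(1), of l j n] by (simp add: not_less)
    then have "AE \<omega> in P i. (if Y n \<omega> = j \<and> (\<forall>k<n. Y k \<omega> \<noteq> 0)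
     then ennreal (exp (l * real_of_ereal (T n \<omega>))) * exp_upto l (soj n \<omega>) else 0) = 0"
      by (subst (asm) nn_integral_0_iff_AE) measurable
    with AE_T_finite[OF i(1), of "Suc n"] AE_space show ?thesis
    proof eventually_elim
      case (elim \<omega>)
      have "0 < ennreal (exp (l * real_of_ereal (T n \<omega>))) * exp_upto l (soj n \<omega>)"
        using exp_upto_pos[OF sojourn_pos[OF rc[OF i(1)] elim(1)]] elim(2)
        by (simp add: ennreal_zero_less_mult_iff)
      with elim(3) show ?case by (metis less_irrefl)
    qed
  qed
  then have AE: "AE \<omega> in P i. \<forall>n. \<not> (Y n \<omega> = j \<and> (\<forall>k<n. Y k \<omega> \<noteq> 0))"
    unfolding AE_all_countable by blast
  obtain t where t: "0 \<le> t" "0 < killed_semigroup P X i j t"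
    using ev i j unfolding evanescent_def by blast
  have "ennreal (killed_semigroup P X i j t) = (\<integral>\<^sup>+\<omega>. 0 \<partial>P i)"
    unfolding killed_semigroup_eq[OF i(1) j(2) t(1)]
  proof (rule nn_integral_cong_AE)
    show "AE \<omega> in P i. (\<Sum>n. if T n \<omega> \<le> ereal t \<and> ereal t < T (Suc n) \<omega> \<and> Y n \<omega> = j \<and> (\<forall>k<n. Y k \<omega> \<noteq> 0)
      then 1 else 0) = (0::ennreal)"
      using AE
    proof eventually_elim
      case (elim \<omega>)
      have "(if T n \<omega> \<le> ereal t \<and> ereal t < T (Suc n) \<omega> \<and> Y n \<omega> = j \<and> (\<forall>k<n. Y k \<omega> \<noteq> 0)
        then 1 else 0) = (0::ennreal)" for n
        using elim by (simp del: jump_time.simps)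
      then show ?case by (simp only: suminf_zero)
    qed
  qed
  with t(2) show False by simp
qed

lemma edges_connected: "i \<in> S \<Longrightarrow> i \<noteq> 0 \<Longrightarrow> j \<in> S \<Longrightarrow> j \<noteq> 0 \<Longrightarrow> (i, j) \<in> edges\<^sup>*"
  using killed_term_pos_exists[of i j 0] edges_of_killed_term by blast

text \<open>Finiteness passes to starting states further along a jump and to targets one jump
  earlier; connectedness of \<open>C\<close> reaches every pair.\<close>

lemma green_finite_transfer:
  assumes i: "i \<in> S" "i \<noteq> 0" "i' \<in> S" "i' \<noteq> 0" and j: "j \<in> S" "j \<noteq> 0" "j' \<in> S" "j' \<noteq> 0"
    and fin: "green l j i < \<infinity>"
  shows "green l j' i' < \<infinity>"
proof -
  have "green l j i' < \<infinity>"
    using edges_connected[OF i]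
  proof (induction rule: rtrancl_induct)
    case (step y z)
    then show ?case using green_forward[of y z l j] by (auto simp: edges_def)
  qed (rule fin)
  with edges_connected[OF j(3,4,1,2)] show ?thesis
  proof (induction rule: converse_rtrancl_induct)
    case (step y z)
    then show ?case using green_backward[of y z i' l] i by (auto simp: edges_def)
  qed
qed

text \<open>At \<open>l = q i\<close> the stay in \<open>i\<close> alone has an infinite exponential
  moment. This makes the set in \<open>decay_parameter\<close> nonempty and its infimum
  meaningful.\<close>

lemma green_infinite:
  assumes i: "i \<in> S" "i \<noteq> 0" and j: "j \<in> S" "j \<noteq> 0"
  shows "green (q i) j i = \<infinity>"
proof -
  obtain n where n: "0 < killed_term (q i) j n i" using killed_term_pos_exists[OF i j] by blast
  have "killed_term (q i) j n i = \<infinity>"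
  proof (cases n)
    case 0
    with n i show ?thesis by (simp add: killed_term_0 lap_infinite split: if_splits)
  next
    case (Suc k)
    define A where "A = (\<Sum>z. p i z * killed_term (q i) j k z)"
    have eq: "killed_term (q i) j n i = ennreal (q i) * \<infinity> * A"
      using i by (simp add: Suc killed_term_Suc lap_infinite A_def)
    with n have "A \<noteq> 0" by (cases "A = 0") simp_all
    moreover have "ennreal (q i) \<noteq> 0" using q_pos[OF i(1)] by simp
    ultimately show ?thesis unfolding eq by (simp add: ennreal_mult_eq_top_iff)
  qed
  with suminf_ge_term[of "\<lambda>n. killed_term (q i) j n i" n] show ?thesis
    by (simp add: green_def top_unique)
qed

text \<open>Otherwise the sum for \<open>hit_mgf 0 c\<close> would be empty, but its value is
  1.\<close>

lemma entry_set_nonempty: "entry_set \<noteq> {}"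
proof
  assume "entry_set = {}"
  obtain c where "c \<in> S" "c \<noteq> 0" using nontrivial by blast
  with hit_mgf_0[of c] hit_mgf_eq[of c 0] \<open>entry_set = {}\<close> show False by simp
qed

lemma exit_set_nonempty: "exit_set \<noteq> {}"
  using sum_exit_set by auto

text \<open>Each term \<open>green 0 j' i * Q j' 0\<close> with \<open>j'\<close> in
  \<open>entry_set\<close> is at most the probability of hitting 0; solidarity then covers the other
  targets.\<close>

lemma green_0_finite:
  assumes i: "i \<in> S" "i \<noteq> 0" and j: "j \<in> S" "j \<noteq> 0"
  shows "green 0 j i < \<infinity>"
proof -
  obtain j' where j': "j' \<in> entry_set" using entry_set_nonempty by blast
  have "green 0 j' i * ennreal (Q j' 0) \<le> (\<Sum>j\<in>entry_set. green 0 j i * ennreal (Q j 0))"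
    by (rule member_le_sum[OF j' _ entry_set(1)]) simp
  also have "\<dots> = 1" using hit_mgf_0[OF i(1)] hit_mgf_eq[OF i] by simp
  finally have "green 0 j' i * ennreal (Q j' 0) < \<infinity>" by (auto simp: less_top[symmetric] top_unique)
  moreover have "0 < ennreal (Q j' 0)" using j' by (simp add: entry_set_def)
  ultimately have "green 0 j' i < \<infinity>" by (auto simp: ennreal_mult_less_top)
  then show ?thesis using green_finite_transfer[OF i i _ _ j, of j'] entry_set(2)[OF j'] by blast
qed

text \<open>Here \<open>a\<close> is \<alpha>. The hypothesis concerns one pair of states;
  solidarity spreads finiteness below \<open>a\<close> and divergence at \<open>a\<close> to all
  pairs.\<close>

lemma alpha_recurrent_threshold:
  assumes "alpha_recurrent S P X"
  obtains a where "0 < a"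
    "\<And>l i j. 0 \<le> l \<Longrightarrow> l < a \<Longrightarrow> i \<in> S \<Longrightarrow> i \<noteq> 0 \<Longrightarrow> j \<in> S \<Longrightarrow> j \<noteq> 0 \<Longrightarrow> green l j i < \<infinity>"
    "\<And>i j. i \<in> S \<Longrightarrow> i \<noteq> 0 \<Longrightarrow> j \<in> S \<Longrightarrow> j \<noteq> 0 \<Longrightarrow> green a j i = \<infinity>"
proof -
  obtain i j where i: "i \<in> S" "i \<noteq> 0" and j: "j \<in> S" "j \<noteq> 0"
    and inf: "killed_integral P X i j (decay_parameter P X i j) = \<infinity>"
    using assms by (auto simp: alpha_recurrent_def)
  have green: "killed_integral P X i j l = green l j i" for l
    unfolding green_def by (rule killed_integral_eq[OF i(1) j(2)])
  define a where "a = decay_parameter P X i j"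
  define L where "L = {l. 0 \<le> l \<and> green l j i = \<infinity>}"
  have a: "a = Inf L" by (simp add: a_def decay_parameter_def L_def green)
  have at_a: "green a j i = \<infinity>" using inf by (simp add: a_def green)
  have bdd: "bdd_below L" by (rule bdd_belowI[of _ 0]) (simp add: L_def)
  have "q i \<in> L" using green_infinite[OF i j] q_pos[OF i(1)] by (simp add: L_def)
  then have "0 \<le> a" unfolding a by (intro cInf_greatest) (auto simp: L_def)
  moreover have "a \<noteq> 0" using green_0_finite[OF i j] at_a by auto
  ultimately have a0: "0 < a" by simp
  have below: "green l j i < \<infinity>" if "0 \<le> l" "l < a" for l
  proof (rule ccontr)
    assume "\<not> ?thesis"
    then have "l \<in> L" using that by (auto simp: L_def less_top[symmetric])
    then have "a \<le> l" unfolding a by (rule cInf_lower[OF _ bdd])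
    with that show False by simp
  qed
  show thesis
  proof (rule that[OF a0])
    fix l i' j' assume "0 \<le> l" "l < a" and ij: "i' \<in> S" "i' \<noteq> 0" "j' \<in> S" "j' \<noteq> 0"
    then show "green l j' i' < \<infinity>" using green_finite_transfer[OF i ij(1,2) j ij(3,4)] below by blast
  next
    fix i' j' assume ij: "i' \<in> S" "i' \<noteq> 0" "j' \<in> S" "j' \<noteq> 0"
    show "green a j' i' = \<infinity>"
    proof (rule ccontr)
      assume "\<not> ?thesis"
      then have "green a j' i' < \<infinity>" by (simp add: less_top)
      then have "green a j i < \<infinity>" by (rule green_finite_transfer[OF ij(1,2) i ij(3,4) j])
      with at_a show False by simp
    qed
  qed
qed

text \<open>The cut at 1 bounds the exponential by \<open>exp l\<close>, so the value is finite also
  for \<open>l\<close> beyond \<open>q 0\<close>.\<close>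

lemma holding_mgf_finite:
  assumes "0 \<le> l"
  shows "holding_mgf l < \<infinity>"
proof -
  interpret expo: prob_space "\<nu> 0" by (intro prob_space_expo q_pos zero)
  have "holding_mgf l \<le> (\<integral>\<^sup>+s. ennreal (exp l) \<partial>\<nu> 0)"
    unfolding holding_mgf_def
  proof (rule nn_integral_mono)
    fix s
    have "exp (l * s) \<le> exp l" if "s < 1" using that assms mult_left_le[of s l] by simp
    then show "(if s < 1 then ennreal (exp (l * s)) else 0) \<le> ennreal (exp l)" by (auto intro: ennreal_leI)
  qed
  also have "\<dots> < \<infinity>" using expo.emeasure_space_1 by simp
  finally show ?thesis .
qed

lemma emeasure_holding_le:
  assumes "0 \<le> s"
  shows "emeasure (\<nu> 0) {..s} = ennreal (1 - exp (- q 0 * s))"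
proof -
  interpret expo: prob_space "\<nu> 0" by (intro prob_space_expo q_pos zero)
  have "emeasure (\<nu> 0) {s<..} = ennreal (exp (- q 0 * s))"
    using emeasure_expo_tail[OF q_pos[OF zero], of s] assms by simp
  then have "expo.prob {s<..} = exp (- q 0 * s)" by (simp add: expo.emeasure_eq_measure)
  moreover have "{..s} = space (\<nu> 0) - {s<..}" by auto
  ultimately show ?thesis by (simp add: expo.emeasure_eq_measure expo.prob_compl del: space_expo)
qed

text \<open>Strict because the holding time exceeds 1 with probability
  \<open>exp (- q 0)\<close>.\<close>

lemma holding_mgf_0_less_1: "holding_mgf 0 < 1"
proof -
  have "holding_mgf 0 \<le> (\<integral>\<^sup>+s. indicator {..1} s \<partial>\<nu> 0)"
    unfolding holding_mgf_def by (rule nn_integral_mono) (simp add: indicator_def)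
  also have "\<dots> = ennreal (1 - exp (- q 0 * 1))" using emeasure_holding_le[of 1] by simp
  also have "\<dots> < 1" by (simp add: ennreal_less_one_iff)
  finally show ?thesis .
qed

lemma holding_mgf_pos:
  assumes "0 \<le> l"
  shows "0 < holding_mgf l"
proof -
  \<comment> \<open>Any point of \<open>(0,1)\<close> would serve in place of
    \<open>1/2\<close>.\<close>
  have "0 < ennreal (1 - exp (- q 0 * (1/2)))" using q_pos[OF zero] by simp
  also have "\<dots> = emeasure (\<nu> 0) {..1/2}" using emeasure_holding_le[of "1/2"] by simp
  finally have pos: "0 < emeasure (\<nu> 0) {..1/2}" .
  show ?thesis
  proof (rule ccontr)
    assume "\<not> ?thesis"
    then have "AE s in \<nu> 0. (if s < 1 then ennreal (exp (l * s)) else 0) = 0"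
      unfolding holding_mgf_def by (subst (asm) not_gr_zero, subst (asm) nn_integral_0_iff_AE) auto
    then have "AE s in \<nu> 0. s \<notin> {..1/2}" by eventually_elim (auto split: if_splits)
    then have "emeasure (\<nu> 0) {..1/2} = 0" by (subst (asm) AE_iff_measurable[of "{..1/2}"]) auto
    with pos show False by simp
  qed
qed

end

section \<open>The value 1 of \<open>I\<close> below the decay parameter\<close>

theorem lemma1p3:
  fixes S :: "nat set"
    and Q :: "nat \<Rightarrow> nat \<Rightarrow> real"
    and P :: "nat \<Rightarrow> 'w measure"
    and X :: "real \<Rightarrow> 'w \<Rightarrow> nat"
    and x\<^sub>0 :: nat
    and g :: "real \<Rightarrow> real"
  assumes "S = UNIV \<or> (\<exists>K. S = {0..K})"
    and "markov_chain S Q P X"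
    and "irreducible_chain S P X"
    and "non_explosive S P X"
    and "recurrent_chain S P X"
    and "evanescent S P X"
    and "x\<^sub>0 \<in> S"
    and "cycle_density (P x\<^sub>0) X g"
    and "alpha_recurrent S P X"
    and "finite {i \<in> S. Q i 0 > 0}"
    and "finite {i \<in> S. Q 0 i > 0}"
  shows "\<exists>\<phi>. cycle_mgf g \<phi> = 1 \<and> finite_left_derivative (cycle_mgf g) \<phi>"
proof -
  interpret evanescent_chain S Q P X
  proof
    show "0 \<in> S" using assms(1) by auto
    \<comment> \<open>\<alpha>-recurrence names a state in \<open>S - {0}\<close>.\<close>
    show "\<exists>c\<in>S. c \<noteq> 0" using assms(9) unfolding alpha_recurrent_def by blast
  qed (fact assms)+
  obtain a where a: "0 < a"
    and below: "\<And>l i j. 0 \<le> l \<Longrightarrow> l < a \<Longrightarrow> i \<in> S \<Longrightarrow> i \<noteq> 0 \<Longrightarrow> j \<in> S \<Longrightarrow> j \<noteq> 0 \<Longrightarrow> green l j i < \<infinity>"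
    and at_a: "\<And>i j. i \<in> S \<Longrightarrow> i \<noteq> 0 \<Longrightarrow> j \<in> S \<Longrightarrow> j \<noteq> 0 \<Longrightarrow> green a j i = \<infinity>"
    using alpha_recurrent_threshold[OF assms(9)] by blast
  have mgf: "cycle_mgf g l = holding_mgf l * (\<Sum>z\<in>exit_set. p 0 z * hit_mgf l z)" for l
    by (rule cycle_mgf_eq[OF assms(7,8)])
  show ?thesis
  proof (rule cycle_mgf_level_one[OF _ a])
    show "g \<in> borel_measurable borel" using assms(8) by (simp add: cycle_density_def)
  next
    fix l assume l: "0 \<le> l" "l < a"
    \<comment> \<open>Finiteness of \<open>entry_set\<close> and \<open>exit_set\<close> acts here:
      only finitely many finite Green functions are added up.\<close>
    have "hit_mgf l z < \<infinity>" if "z \<in> exit_set" for z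
      using exit_set(2)[OF that] entry_set below[OF l, of z]
      by (simp add: hit_mgf_eq ennreal_mult_less_top)
    moreover have "p 0 z < \<infinity>" for z by (simp add: p_def)
    ultimately show "cycle_mgf g l < \<infinity>"
      unfolding mgf using holding_mgf_finite[OF l(1)] exit_set(1) by (simp add: ennreal_mult_less_top)
  next
    \<comment> \<open>A single pair of an exit state \<open>z\<close> and an entry state
      \<open>j\<close> already makes the nonnegative sum infinite at \<open>a\<close>.\<close>
    obtain z where z: "z \<in> exit_set" using exit_set_nonempty by blast
    obtain j where j: "j \<in> entry_set" using entry_set_nonempty by blast
    have "green a j z * ennreal (Q j 0) = \<infinity>"
      using j at_a entry_set(2)[OF j] exit_set(2)[OF z] by (simp add: entry_set_def ennreal_mult_eq_top_iff)
    then have "hit_mgf a z = \<infinity>"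
      using j entry_set(1) exit_set(2)[OF z] by (auto simp: hit_mgf_eq)
    moreover have "0 < p 0 z" using z exit_set(2)[OF z] zero by (simp add: p_pos_iff exit_set_def)
    ultimately have "(\<Sum>z\<in>exit_set. p 0 z * hit_mgf a z) = \<infinity>"
      using z exit_set(1) by (auto simp: ennreal_mult_eq_top_iff)
    then show "cycle_mgf g a = \<infinity>"
      unfolding mgf using holding_mgf_pos[of a] a by (simp add: ennreal_mult_eq_top_iff)
  next
    \<comment> \<open>At \<open>l = 0\<close> the excursion factor is 1, so only the probability of
      \<open>H < 1\<close> is left.\<close>
    have "hit_mgf 0 z = 1" if "z \<in> exit_set" for z using exit_set(2)[OF that] hit_mgf_0 by blast
    then have "cycle_mgf g 0 = holding_mgf 0" unfolding mgf by (simp add: sum_exit_set)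
    then show "cycle_mgf g 0 < 1" using holding_mgf_0_less_1 by simp
  qed
qed

end
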